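(* Suppose that the scaling function $\omega$ satisfies: there exists $\beta\in(1-\alpha/2,1]$ such that $\omega(\lambda x)=\lambda^{-\beta}\omega(x)$ for all $\lambda>0$ and $x\in\mathbb{R}^d\setminus\{0\}$, and $c_\omega:=\sup_{x\in\mathbb{S}^{d-1}}\omega(x)<\infty$. Suppose that $R_\infty$ has a unique minimizer $V_\infty^*$ in $\mathcal{V}_p$. Then for any minimizer $V_t^*$ of $R_t$ in $\mathcal{V}_p$ one has $$\lim_{t\to\infty}\rho(V_t^*,V_\infty^* )=0.$$
   Context: Let $\|\cdot\|$ be the Euclidean norm on $\mathbb{R}^d$ and $\mathbb{S}^{d-1}=\{x\in\mathbb{R}^d:\|x\|=1\}$. $X$ is an $\mathbb{R}^d$-valued random vector (probability $\mathbb{P}$, expectation $\mathbb{E}$) that is regularly varying: there exist a function $b:(0,\infty)\to(0,\infty)$ and a non-zero Borel measure $\mu$ on $\mathbb{R}^d\setminus\{0\}$ such that $b(t)^{-1}\mathbb{P}(X\in tB)\to\mu(B)<\infty$ as $t\to\infty$ for all Borel sets $B$ bounded away from the origin with $\mu(\partial B)=0$. Then $\mu$ is homogeneous of order $-\alpha$ for some $\alpha>0$, i.e. $\mu(\lambda B)=\lambda^{-\alpha}\mu(B)$ for $\lambda>0$; this defines $\alpha$. $P_t(\cdot)=\mathbb{P}(X\in\cdot\mid\|X\|>t)$ for $t>0$, $\mathbb{E}_t$ is the conditional expectation given $\|X\|>t$, and $P_\infty(\cdot)=\mu(\cdot\cap\{\|x\|>1\})/\mu\{\|x\|>1\}$ is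 the weak limit of $P_t(t\,\cdot)$. For a probability measure $Q$, $Qf=\int f\,dQ$. The scaling function is a measurable $\omega:\mathbb{R}^d\setminus\{0\}\to(0,\infty)$; $\theta(x)=\omega(x)x$ for $x\ne0$, $\theta(0)=0$, and $\Theta=\theta(X)$. For a linear subspace $V\subset\mathbb{R}^d$, $\mathbf{\Pi}_V$ and $\mathbf{\Pi}_V^\perp$ denote the orthogonal projections onto $V$ and onto its orthogonal complement. The risks are $R_t(V)=P_t(\|\mathbf{\Pi}_V^\perp\theta\|^2)=\mathbb{E}_t(\|\mathbf{\Pi}_V^\perp\Theta\|^2)$ and $R_\infty(V)=P_\infty(\|\mathbf{\Pi}_V^\perp\theta\|^2)$. For $1\le p\le d$, $\mathcal{V}_p$ is the set of all linear subspaces of $\mathbb{R}^d$ of dimension $p$, with the metric $\rho(V,W)=\sup_{x\in\mathbb{S}^{d-1}}\|\mathbf{\Pi}_Vx-\mathbf{\Pi}_Wx\|$ (operator norm of $\mathbf{\Pi}_V-\mathbf{\Pi}_W$).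
   Formalization: The scaling function ω is additionally assumed continuous μ-almost everywhere; for merely measurable ω the claim fails, e.g. when μ sits on the axes, X never does, and ω is enlarged on one axis. *)

theory Defs
  imports "HOL-Probability.Probability"
begin

text \<open>
  Measures on the punctured space are measures on the trace sigma-algebra of
  \<^term>\<open>- {0}\<close>. For a Borel set \<open>B\<close> with \<^term>\<open>0 \<notin> closure B\<close> the boundary in the whole
  space and the boundary in the punctured space coincide.
\<close>

definition regularly_varying ::
  "'w measure \<Rightarrow> ('w \<Rightarrow> 'a::euclidean_space) \<Rightarrow> (real \<Rightarrow> real) \<Rightarrow> 'a measure \<Rightarrow> bool" where
  "regularly_varying M X b \<mu> \<longleftrightarrow>
     (\<forall>t>0. b t > 0) \<and>
     sets \<mu> = sets (restrict_space borel (- {0})) \<and>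
     emeasure \<mu> (space \<mu>) \<noteq> 0 \<and>
     (\<forall>B\<in>sets borel. 0 \<notin> closure B \<longrightarrow> emeasure \<mu> (frontier B) = 0 \<longrightarrow>
        emeasure \<mu> B < \<infinity> \<and>
        ((\<lambda>t. measure M {w \<in> space M. X w \<in> (*\<^sub>R) t ` B} / b t) \<longlongrightarrow> measure \<mu> B) at_top)"

definition homogeneous_measure :: "'a::euclidean_space measure \<Rightarrow> real \<Rightarrow> bool" where
  "homogeneous_measure \<mu> \<kappa> \<longleftrightarrow>
     (\<forall>c>0. \<forall>B\<in>sets \<mu>. emeasure \<mu> ((*\<^sub>R) c ` B) = ennreal (c powr \<kappa>) * emeasure \<mu> B)"

definition P_cond :: "'w measure \<Rightarrow> ('w \<Rightarrow> 'a::euclidean_space) \<Rightarrow> real \<Rightarrow> 'a measure" where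
  "P_cond M X t = distr (uniform_measure M {w \<in> space M. norm (X w) > t}) borel X"

text \<open>
  The limit law lives on the punctured space, as \<open>\<mu>\<close> does:
  \<open>B \<mapsto> \<mu> ({x. norm x > 1} \<inter> B) / \<mu> {x. norm x > 1}\<close>.
\<close>

definition P_lim :: "'a::euclidean_space measure \<Rightarrow> 'a measure" where
  "P_lim \<mu> = uniform_measure \<mu> {x. norm x > 1}"

definition rescale :: "('a::euclidean_space \<Rightarrow> real) \<Rightarrow> 'a \<Rightarrow> 'a" where
  "rescale \<omega> x = (if x = 0 then 0 else \<omega> x *\<^sub>R x)"

definition orth_proj :: "'a::euclidean_space set \<Rightarrow> 'a \<Rightarrow> 'a" where
  "orth_proj V x = (THE v. v \<in> V \<and> (\<forall>w\<in>V. orthogonal (x - v) w))"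

lemma orth_proj_unique:
  assumes V: "subspace V" and "v \<in> V" "\<And>w. w \<in> V \<Longrightarrow> orthogonal (x - v) w"
  shows "orth_proj V x = v"
  unfolding orth_proj_def
proof (rule the_equality)
  fix u assume u: "u \<in> V \<and> (\<forall>w\<in>V. orthogonal (x - u) w)"
  have "u - v \<in> V" using V u assms(2) by (simp add: subspace_diff)
  then have "(x - v) \<bullet> (u - v) = 0" "(x - u) \<bullet> (u - v) = 0"
    using u assms(3) by (auto simp: orthogonal_def)
  then have "(u - v) \<bullet> (u - v) = 0" by (simp add: inner_diff_left)
  then show "u = v" by simp
qed (use assms in auto)

lemma
  assumes V: "subspace V"
  shows orth_proj_mem: "orth_proj V x \<in> V"
    and orth_proj_orthogonal: "w \<in> V \<Longrightarrow> orthogonal (x - orth_proj V x) w"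
proof -
  obtain y z where y: "y \<in> span V" "\<And>w. w \<in> span V \<Longrightarrow> orthogonal z w" "x = y + z"
    using orthogonal_subspace_decomp_exists by blast
  moreover have "span V = V" using V by (simp add: span_eq_iff)
  ultimately have *: "y \<in> V" "\<And>w. w \<in> V \<Longrightarrow> orthogonal (x - y) w" by auto
  then have "orth_proj V x = y" using orth_proj_unique[OF V] by blast
  with * show "orth_proj V x \<in> V" "w \<in> V \<Longrightarrow> orthogonal (x - orth_proj V x) w" by auto
qed

text \<open>
  Reconstruction risk under the law \<open>Q\<close>. It is a Bochner integral. If \<open>\<omega>\<close> is homogeneous of
  order \<open>- \<beta>\<close> with \<open>2 * (1 - \<beta>) < \<alpha>\<close> and bounded on the unit sphere, the integrand is at most
  a constant times \<open>norm x powr (2 * (1 - \<beta>))\<close>, which is integrable under \<^const>\<open>P_cond\<close> and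
  \<^const>\<open>P_lim\<close> when the tail index is \<open>\<alpha>\<close>; the default value for non-integrable functions then
  plays no role.
\<close>

definition risk :: "'a::euclidean_space measure \<Rightarrow> ('a \<Rightarrow> real) \<Rightarrow> 'a set \<Rightarrow> real" where
  "risk Q \<omega> V = (LINT x|Q. (norm (orth_proj (orthogonal_comp V) (rescale \<omega> x)))\<^sup>2)"

definition subspaces_dim :: "nat \<Rightarrow> 'a::euclidean_space set set" where
  "subspaces_dim p = {V. subspace V \<and> dim V = p}"

definition subspace_dist :: "'a::euclidean_space set \<Rightarrow> 'a set \<Rightarrow> real" where
  "subspace_dist V W = (SUP x\<in>sphere 0 1. norm (orth_proj V x - orth_proj W x))"

end

theory Submission
  imports Defs
begin

text \<open>
  The risk \<open>R\<^sub>t\<close> is the expectation of \<open>h\<^sub>W (X)\<close> given \<open>norm X > t\<close>, where \<open>h\<^sub>W (x)\<close> is the squared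
  distance of \<open>rescale \<omega> x\<close> from \<open>W\<close>. By homogeneity of \<open>\<omega>\<close>, \<open>h\<^sub>W\<close> is homogeneous of order
  \<open>\<gamma> = 2 * (1 - \<beta>)\<close>, so \<open>R\<^sub>t\<close> equals \<open>t powr \<gamma>\<close> times the conditional expectation of \<open>h\<^sub>W (X / t)\<close>. The
  factor does not depend on \<open>W\<close>; hence the minimizers of \<open>R\<^sub>t\<close> are those of the scaled risk, and
  the proof compares the scaled risk with \<open>R\<^sub>\<infinity>\<close>.
  
  For a fixed \<open>W\<close> the scaled risk tends to \<open>R\<^sub>\<infinity>\<close> (\<open>conditional_expectation_limit\<close>). Regular variation
  gives convergence of the conditional probabilities of \<open>\<mu>\<close>-continuity sets, and applied to the
  sublevel sets of an almost everywhere continuous \<open>f\<close> this is weak convergence of the law of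
  \<open>f (X / t)\<close> on the real line (\<open>conditional_law_weak_conv\<close>). The function \<open>h\<^sub>W\<close> is unbounded, so a
  uniform moment bound must be added. It comes from the tails: the ratio of \<open>P (norm X > 2 * t)\<close> to
  \<open>P (norm X > t)\<close> tends to \<open>2 powr - \<alpha>\<close>, and iterating this bound along powers of two keeps all
  conditional moments of \<open>norm (X / t)\<close> of order below \<open>\<alpha>\<close> bounded for large \<open>t\<close>
  (\<open>moments_bounded\<close>). Since \<open>\<gamma> < \<alpha>\<close>, some power \<open>q > 1\<close> of \<open>h\<^sub>W (X / t)\<close> is covered.
  
  The passage from fixed \<open>W\<close> to the moving minimizers uses two more facts. The scaled risks are, for
  large \<open>t\<close>, Lipschitz in the orthogonal projection with a common constant
  (\<open>scaled_risk_lipschitz\<close>), and the set of \<open>p\<close>-dimensional subspaces is compact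
  (\<open>subspaces_dim_sequentially_compact\<close>). If the minimizers stayed away from \<open>V_inf\<close> along a sequence
  \<open>t\<^sub>n\<close>, a subsequence would converge to some \<open>W\<close>; comparing scaled risks at \<open>V t\<^sub>n\<close> and \<open>V_inf\<close> and
  passing to the limit shows that \<open>W\<close> minimizes \<open>R\<^sub>\<infinity>\<close>, so \<open>W = V_inf\<close>, a contradiction.
  
  All of this requires that \<open>\<mu>\<close> give finite mass to \<open>{x. 1 < norm x}\<close>. The definition of regular
  variation asserts finiteness only on sets whose boundary is a null set, and infinity times the
  counting measure on the punctured space satisfies it and is homogeneous. When the mass is infinite, \<^const>\<open>P_lim\<close> is the zero
  measure, every \<open>p\<close>-dimensional subspace minimizes \<open>R\<^sub>\<infinity>\<close>, and by uniqueness there is only one such subspace.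
\<close>

section \<open>Orthogonal projections and compactness of the Grassmannian\<close>

lemma orth_proj_add:
  assumes "subspace V" shows "orth_proj V (x + y) = orth_proj V x + orth_proj V y"
proof (rule orth_proj_unique[OF assms])
  show "orth_proj V x + orth_proj V y \<in> V"
    by (simp add: assms orth_proj_mem subspace_add)
  fix w assume w: "w \<in> V"
  show "orthogonal (x + y - (orth_proj V x + orth_proj V y)) w"
    using orth_proj_orthogonal[OF assms w, of x] orth_proj_orthogonal[OF assms w, of y]
    by (simp add: orthogonal_def algebra_simps)
qed

lemma orth_proj_scaleR:
  assumes "subspace V" shows "orth_proj V (c *\<^sub>R x) = c *\<^sub>R orth_proj V x"
proof (rule orth_proj_unique[OF assms])
  show "c *\<^sub>R orth_proj V x \<in> V"
    by (simp add: assms orth_proj_mem subspace_scale)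
  fix w assume w: "w \<in> V"
  show "orthogonal (c *\<^sub>R x - c *\<^sub>R orth_proj V x) w"
    using orth_proj_orthogonal[OF assms w, of x]
    by (simp add: orthogonal_def algebra_simps)
qed

lemma orth_proj_eq_self:
  assumes "subspace V" "x \<in> V" shows "orth_proj V x = x"
  using assms by (intro orth_proj_unique) (auto simp: orthogonal_def)

lemma orth_proj_self_adjoint:
  assumes "subspace V" shows "orth_proj V x \<bullet> y = x \<bullet> orth_proj V y"
  using orth_proj_orthogonal[OF assms orth_proj_mem[OF assms], of x y]
    orth_proj_orthogonal[OF assms orth_proj_mem[OF assms], of y x]
  by (simp add: orthogonal_def inner_diff_left inner_diff_right inner_commute)

lemma norm_orth_proj_le:
  assumes "subspace V" shows "norm (orth_proj V x) \<le> norm x"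
proof -
  have "orth_proj V x \<bullet> orth_proj V x = x \<bullet> orth_proj V x"
    using orth_proj_self_adjoint[OF assms, of x "orth_proj V x"]
    by (simp add: orth_proj_eq_self assms orth_proj_mem)
  then have "(norm (orth_proj V x))\<^sup>2 \<le> norm x * norm (orth_proj V x)"
    by (metis norm_cauchy_schwarz power2_norm_eq_inner)
  then show ?thesis
    by (cases "norm (orth_proj V x) = 0") (auto simp: power2_eq_square)
qed

lemma orth_proj_orthogonal_comp:
  assumes "subspace V" shows "orth_proj (orthogonal_comp V) x = x - orth_proj V x"
proof (rule orth_proj_unique)
  show "subspace (orthogonal_comp V)" by (rule subspace_orthogonal_comp)
  show "x - orth_proj V x \<in> orthogonal_comp V"
    using orth_proj_orthogonal[OF assms] by (auto simp: orthogonal_comp_def orthogonal_commute)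
  show "orthogonal (x - (x - orth_proj V x)) w" if "w \<in> orthogonal_comp V" for w
    using that orth_proj_mem[OF assms, of x] by (auto simp: orthogonal_comp_def)
qed

lemma bounded_linear_orth_proj:
  assumes "subspace V" shows "bounded_linear (orth_proj V)"
  using assms norm_orth_proj_le[OF assms]
  by (intro bounded_linear_intro[where K = 1]) (auto simp: orth_proj_add orth_proj_scaleR)

text \<open>
  Regarding projections as elements of the normed space of bounded operators gives access to its
  Heine-Borel property.
\<close>

definition proj_blinfun :: "'a::euclidean_space set \<Rightarrow> 'a \<Rightarrow>\<^sub>L 'a" where
  "proj_blinfun V = Blinfun (orth_proj V)"

lemma proj_blinfun_apply:
  assumes "subspace V" shows "blinfun_apply (proj_blinfun V) = orth_proj V"
  unfolding proj_blinfun_def by (rule bounded_linear_Blinfun_apply[OF bounded_linear_orth_proj[OF assms]])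

lemma norm_proj_blinfun_le:
  assumes "subspace V" shows "norm (proj_blinfun V) \<le> 1"
  by (rule norm_blinfun_bound) (auto simp: proj_blinfun_apply assms norm_orth_proj_le)

lemma norm_orth_proj_diff_le:
  assumes "subspace V" "subspace W"
  shows "norm (orth_proj V x - orth_proj W x) \<le> norm (proj_blinfun V - proj_blinfun W) * norm x"
  using norm_blinfun[of "proj_blinfun V - proj_blinfun W" x]
  by (simp add: proj_blinfun_apply assms blinfun.diff_left)

text \<open>
  \<^const>\<open>subspace_dist\<close> is a supremum over the sphere, hence controlled by the operator norm; only
  this direction is used to transfer convergence.
\<close>

lemma subspace_dist_bounds:
  fixes V W :: "'a::euclidean_space set"
  assumes "subspace V" "subspace W"
  shows "0 \<le> subspace_dist V W" "subspace_dist V W \<le> norm (proj_blinfun V - proj_blinfun W)"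
proof -
  have le: "norm (orth_proj V x - orth_proj W x) \<le> norm (proj_blinfun V - proj_blinfun W)"
    if "x \<in> sphere 0 1" for x
    using norm_orth_proj_diff_le[OF assms, of x] that by simp
  obtain e :: 'a where e: "e \<in> sphere 0 1"
    using vector_choose_size[of 1] by auto
  show "subspace_dist V W \<le> norm (proj_blinfun V - proj_blinfun W)"
    unfolding subspace_dist_def using e le by (intro cSUP_least) auto
  show "0 \<le> subspace_dist V W"
    unfolding subspace_dist_def using e le
    by (intro cSUP_upper2[where x = e] bdd_aboveI2[where M = "norm (proj_blinfun V - proj_blinfun W)"]) auto
qed

text \<open>
  If \<open>x \<in> W\<close> has zero projection to \<open>V\<close>, then \<open>x\<close> is its own image under the difference of the two
  projections, which strictly shrinks every non-zero vector. So the projection to \<open>V\<close> is injective on \<open>W\<close>.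
\<close>

lemma dim_le_of_proj_close:
  fixes V W :: "'a::euclidean_space set"
  assumes "subspace V" "subspace W" "norm (proj_blinfun V - proj_blinfun W) < 1"
  shows "dim W \<le> dim V"
proof -
  have lin: "linear (orth_proj V)"
    using bounded_linear_orth_proj[OF assms(1)] by (rule bounded_linear.linear)
  have "inj_on (orth_proj V) W"
  proof (subst linear_inj_on_iff_eq_0[OF lin assms(2)], intro ballI impI)
    fix x assume x: "x \<in> W" "orth_proj V x = 0"
    have "norm x \<le> norm (proj_blinfun V - proj_blinfun W) * norm x"
      using norm_orth_proj_diff_le[OF assms(1,2), of x] x by (simp add: orth_proj_eq_self assms)
    then show "x = 0"
      using mult_strict_right_mono[OF assms(3), of "norm x"] by (cases "x = 0") auto
  qed
  then have "dim W = dim (orth_proj V ` W)"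
    using lin span_eq_iff[of W] assms(2) by (metis dim_image_eq)
  also have "\<dots> \<le> dim V"
    by (rule dim_subset) (auto simp: orth_proj_mem assms(1))
  finally show ?thesis .
qed

lemma proj_blinfun_range:
  fixes P :: "'a::euclidean_space \<Rightarrow>\<^sub>L 'a"
  assumes idem: "\<And>x. blinfun_apply P (blinfun_apply P x) = blinfun_apply P x"
    and sym: "\<And>x y. blinfun_apply P x \<bullet> y = x \<bullet> blinfun_apply P y"
  shows "subspace (range (blinfun_apply P))" "proj_blinfun (range (blinfun_apply P)) = P"
proof -
  show sub: "subspace (range (blinfun_apply P))"
    using linear_subspace_image[OF bounded_linear.linear[OF blinfun.bounded_linear_right] subspace_UNIV] .
  have "orth_proj (range (blinfun_apply P)) x = blinfun_apply P x" for x
  proof (intro orth_proj_unique sub)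
    fix w assume "w \<in> range (blinfun_apply P)"
    then obtain y where "w = blinfun_apply P y" by blast
    then have "x \<bullet> w = blinfun_apply P x \<bullet> w"
      using sym[of x w] idem[of y] by simp
    then show "orthogonal (x - blinfun_apply P x) w"
      by (simp add: orthogonal_def inner_diff_left)
  qed blast
  then show "proj_blinfun (range (blinfun_apply P)) = P"
    by (intro blinfun_eqI) (simp add: proj_blinfun_apply sub)
qed

text \<open>
  Projections have norm at most one, so some subsequence converges to an operator. Being idempotent
  and self-adjoint is a closed condition, hence the limit is again a projection, and its range has
  the right dimension because projections at distance less than one have equal rank.
\<close>

lemma subspaces_dim_sequentially_compact:
  fixes V :: "nat \<Rightarrow> 'a::euclidean_space set"
  assumes V: "\<And>n. V n \<in> subspaces_dim p"
  obtains r W where "strict_mono r" "W \<in> subspaces_dim p"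
    "(\<lambda>n. proj_blinfun (V (r n))) \<longlonglongrightarrow> proj_blinfun W"
proof -
  have sub: "subspace (V n)" "dim (V n) = p" for n
    using V by (auto simp: subspaces_dim_def)
  have "bounded (range (\<lambda>n. proj_blinfun (V n)))"
    unfolding bounded_iff using norm_proj_blinfun_le[OF sub(1)] by blast
  then obtain P r where r: "strict_mono r" and "((\<lambda>n. proj_blinfun (V n)) \<circ> r) \<longlonglongrightarrow> P"
    using bounded_imp_convergent_subsequence[of "\<lambda>n. proj_blinfun (V n)"] by blast
  then have lim: "(\<lambda>n. proj_blinfun (V (r n))) \<longlonglongrightarrow> P"
    by (simp add: comp_def)
  note lims = tendsto_intros lim
  have "blinfun_apply P (blinfun_apply P x) = blinfun_apply P x" for x
  proof (rule LIMSEQ_unique)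
    show "(\<lambda>n. blinfun_apply (proj_blinfun (V (r n))) (blinfun_apply (proj_blinfun (V (r n))) x))
        \<longlonglongrightarrow> blinfun_apply P (blinfun_apply P x)"
      by (intro lims)
    have "(\<lambda>n. blinfun_apply (proj_blinfun (V (r n))) x) \<longlonglongrightarrow> blinfun_apply P x"
      by (intro lims)
    then show "(\<lambda>n. blinfun_apply (proj_blinfun (V (r n))) (blinfun_apply (proj_blinfun (V (r n))) x))
        \<longlonglongrightarrow> blinfun_apply P x"
      by (simp add: proj_blinfun_apply sub orth_proj_eq_self orth_proj_mem)
  qed
  moreover have "blinfun_apply P x \<bullet> y = x \<bullet> blinfun_apply P y" for x y
  proof (rule LIMSEQ_unique)
    show "(\<lambda>n. blinfun_apply (proj_blinfun (V (r n))) x \<bullet> y) \<longlonglongrightarrow> blinfun_apply P x \<bullet> y"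
      by (intro lims)
    have "(\<lambda>n. x \<bullet> blinfun_apply (proj_blinfun (V (r n))) y) \<longlonglongrightarrow> x \<bullet> blinfun_apply P y"
      by (intro lims)
    then show "(\<lambda>n. blinfun_apply (proj_blinfun (V (r n))) x \<bullet> y) \<longlonglongrightarrow> x \<bullet> blinfun_apply P y"
      by (simp add: proj_blinfun_apply sub orth_proj_self_adjoint)
  qed
  ultimately obtain W where W: "subspace W" "proj_blinfun W = P"
    using proj_blinfun_range[of P] by blast
  obtain n where n: "norm (proj_blinfun (V (r n)) - proj_blinfun W) < 1"
    using LIMSEQ_D[OF lim, of 1] W by auto
  then have "dim W = p"
    using dim_le_of_proj_close[OF sub(1) W(1) n] dim_le_of_proj_close[OF W(1) sub(1), of "r n"] sub(2)[of "r n"]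
    by (simp add: norm_minus_commute)
  with W r lim show ?thesis
    by (intro that[of r W]) (auto simp: subspaces_dim_def)
qed

section \<open>Uniform integrability\<close>

text \<open>
  Clipping at \<open>\<plusminus> K\<close> gives a bounded continuous function, to which weak convergence applies; by the
  bound on the moments of order \<open>q > 1\<close>, clipping changes all the means by at most
  \<open>K powr (1 - q) * B\<close>, which vanishes as \<open>K\<close> grows.
\<close>

lemma weak_conv_integral_bounded_moments:
  fixes \<nu> :: "nat \<Rightarrow> real measure" and N :: "real measure"
  assumes \<nu>: "\<And>n. real_distribution (\<nu> n)" and N: "real_distribution N"
    and conv: "weak_conv_m \<nu> N"
    and q: "1 < q"
    and mom: "\<And>n. integrable (\<nu> n) (\<lambda>y. \<bar>y\<bar> powr q)" "\<And>n. (LINT y|\<nu> n. \<bar>y\<bar> powr q) \<le> B"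
    and momN: "integrable N (\<lambda>y. \<bar>y\<bar> powr q)" "(LINT y|N. \<bar>y\<bar> powr q) \<le> B"
  shows "(\<lambda>n. LINT y|\<nu> n. y) \<longlonglongrightarrow> (LINT y|N. y)"
proof -
  define cl :: "real \<Rightarrow> real \<Rightarrow> real" where "cl K y = max (- K) (min K y)" for K y
  have cl_bd: "\<bar>cl K y\<bar> \<le> K" if "K > 0" for K y
    using that by (auto simp: cl_def)
  have cl_cont: "isCont (cl K) y" for K y
    unfolding cl_def by (intro continuous_intros)
  have cl_meas [measurable]: "cl K \<in> borel_measurable borel" for K
    unfolding cl_def by measurable
  have err: "\<bar>y - cl K y\<bar> \<le> K powr (1 - q) * \<bar>y\<bar> powr q" if K: "K > 0" for K y
  proof (cases "\<bar>y\<bar> \<le> K")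
    case True
    then have "cl K y = y" by (auto simp: cl_def)
    then show ?thesis by simp
  next
    case False
    have "\<bar>y - cl K y\<bar> \<le> \<bar>y\<bar>" using False K by (auto simp: cl_def)
    also have "\<bar>y\<bar> = \<bar>y\<bar> powr (1 - q) * \<bar>y\<bar> powr q"
      using False K by (simp add: powr_add[symmetric])
    also have "\<dots> \<le> K powr (1 - q) * \<bar>y\<bar> powr q"
      using False K q by (intro mult_right_mono powr_mono2') auto
    finally show ?thesis .
  qed
  have trunc: "\<bar>(LINT y|D. y) - (LINT y|D. cl K y)\<bar> \<le> K powr (1 - q) * B"
    if D: "real_distribution D" "integrable D (\<lambda>y. \<bar>y\<bar> powr q)" "(LINT y|D. \<bar>y\<bar> powr q) \<le> B"
      and K: "K > 0" for D K
  proof -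
    interpret D: real_distribution D by fact
    have int_cl: "integrable D (cl K)"
      by (rule D.integrable_const_bound[where B = K]) (auto simp: cl_bd K)
    have "integrable D (\<lambda>y. y - cl K y)"
      by (rule Bochner_Integration.integrable_bound[OF integrable_mult_right[OF D(2), of "K powr (1 - q)"]])
         (auto simp: err K intro!: AE_I2)
    then have int: "integrable D (\<lambda>y. y)" "integrable D (\<lambda>y. y - cl K y)"
      using Bochner_Integration.integrable_add[OF _ int_cl, of "\<lambda>y. y - cl K y"] by auto
    have "\<bar>(LINT y|D. y) - (LINT y|D. cl K y)\<bar> = \<bar>LINT y|D. y - cl K y\<bar>"
      using int int_cl by simp
    also have "\<dots> \<le> (LINT y|D. \<bar>y - cl K y\<bar>)"
      by (rule integral_abs_bound)
    also have "\<dots> \<le> (LINT y|D. K powr (1 - q) * \<bar>y\<bar> powr q)"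
      using int D(2) err[OF K] by (intro integral_mono) auto
    also have "\<dots> \<le> K powr (1 - q) * B"
      using D(3) by (auto intro!: mult_left_mono)
    finally show ?thesis .
  qed
  show ?thesis
  proof (rule LIMSEQ_I)
    fix e :: real assume e: "e > 0"
    have "((\<lambda>K. K powr (1 - q) * B) \<longlongrightarrow> 0 * B) at_top"
      using q by (intro tendsto_intros tendsto_neg_powr filterlim_ident) auto
    then have "eventually (\<lambda>K. K powr (1 - q) * B < e / 3) at_top"
      using e by (intro order_tendstoD(2)) auto
    from eventually_happens'[OF _ eventually_conj[OF this eventually_gt_at_top[of 0]]]
    obtain K where K: "K > 0" "K powr (1 - q) * B < e / 3" by auto
    have "(\<lambda>n. LINT y|\<nu> n. cl K y) \<longlonglongrightarrow> (LINT y|N. cl K y)"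
      by (rule weak_conv_imp_integral_bdd_continuous_conv[OF \<nu> N conv cl_cont, where B = K])
         (simp add: cl_bd K)
    then obtain n0 where n0: "\<And>n. n \<ge> n0 \<Longrightarrow> \<bar>(LINT y|\<nu> n. cl K y) - (LINT y|N. cl K y)\<bar> < e / 3"
      using e LIMSEQ_D[of "\<lambda>n. LINT y|\<nu> n. cl K y" "LINT y|N. cl K y" "e / 3"]
      unfolding real_norm_def by (metis divide_pos_pos zero_less_numeral)
    have "\<bar>(LINT y|\<nu> n. y) - (LINT y|N. y)\<bar> < e" if "n \<ge> n0" for n
      using n0[OF that] K(2) trunc[OF \<nu>[of n] mom(1)[of n] mom(2)[of n] K(1)] trunc[OF N momN K(1)] 
      by linarith
    then show "\<exists>no. \<forall>n\<ge>no. norm ((LINT y|\<nu> n. y) - (LINT y|N. y)) < e"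
      by auto
  qed
qed

text \<open>
  Cut the range of \<open>Z\<close> at the powers of two. On \<open>{2 ^ n < Z \<le> 2 ^ Suc n}\<close> the integrand is at most
  \<open>(2 ^ Suc n) powr \<delta>\<close>, so the moment is dominated by a geometric series of ratio
  \<open>2 powr (\<delta> - \<epsilon>) < 1\<close>. The summand 1 accounts for \<open>{Z \<le> 1}\<close>.
\<close>

lemma moment_bound_of_dyadic_tail:
  assumes "prob_space U" and Z [measurable]: "Z \<in> borel_measurable U" and nn: "\<And>w. 0 \<le> Z w"
    and \<delta>: "0 \<le> \<delta>" "\<delta> < \<epsilon>"
    and tail: "\<And>n. measure U {w \<in> space U. Z w > 2 ^ n} \<le> (2 powr - \<epsilon>) ^ n"
  shows "integrable U (\<lambda>w. Z w powr \<delta>)"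
    and "(LINT w|U. Z w powr \<delta>) \<le> 1 + 2 powr \<delta> / (1 - 2 powr (\<delta> - \<epsilon>))"
proof -
  interpret prob_space U by fact
  define r where "r = 2 powr (\<delta> - \<epsilon>)"
  have r: "0 < r" "r < 1" using \<delta> by (auto simp: r_def powr_less_one)
  define A where "A n = {w \<in> space U. Z w > 2 ^ n}" for n
  have [measurable]: "A n \<in> sets U" for n unfolding A_def by measurable
  have pw: "ennreal (Z w powr \<delta>) \<le> 1 + (\<Sum>n. ennreal ((2 ^ Suc n) powr \<delta>) * indicator (A n) w)"
    if w: "w \<in> space U" for w
  proof (cases "Z w \<le> 1")
    case True
    then have "Z w powr \<delta> \<le> 1" using nn \<delta> by (intro powr_le1) auto
    then have "ennreal (Z w powr \<delta>) \<le> 1" by (metis ennreal_1 ennreal_leI)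
    then show ?thesis by (metis add.right_neutral add_mono zero_le)
  next
    case False
    define k where "k = (LEAST k. Z w \<le> 2 ^ k)"
    have ex: "Z w \<le> 2 ^ k"
      unfolding k_def by (rule LeastI_ex) (metis less_imp_le one_less_numeral_iff real_arch_pow semiring_norm(76))
    with False obtain n where n: "k = Suc n" by (cases k) auto
    then have "\<not> Z w \<le> 2 ^ n" unfolding k_def by (intro not_less_Least) auto
    then have "w \<in> A n" using w by (auto simp: A_def)
    then have "ennreal (Z w powr \<delta>) \<le> ennreal ((2 ^ Suc n) powr \<delta>) * indicator (A n) w"
      using ex n nn \<delta> by (auto intro!: ennreal_leI powr_mono2)
    also have "\<dots> \<le> (\<Sum>n. ennreal ((2 ^ Suc n) powr \<delta>) * indicator (A n) w)"
      (is "?a n \<le> _")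
      using sum_le_suminf[of ?a "{n}"] by (simp only: sum.insert_if finite.emptyI sum.empty) simp
    also have "\<dots> \<le> 1 + \<dots>" by simp
    finally show ?thesis .
  qed
  have "(\<integral>\<^sup>+w. ennreal (Z w powr \<delta>) \<partial>U) \<le> (\<integral>\<^sup>+w. 1 + (\<Sum>n. ennreal ((2 ^ Suc n) powr \<delta>) * indicator (A n) w) \<partial>U)"
    by (intro nn_integral_mono pw)
  also have "\<dots> = 1 + (\<Sum>n. ennreal ((2 ^ Suc n) powr \<delta>) * emeasure U (A n))"
    by (subst nn_integral_add) (auto simp: nn_integral_suminf nn_integral_cmult emeasure_space_1)
  also have "\<dots> \<le> 1 + (\<Sum>n. ennreal (2 powr \<delta> * r ^ n))"
  proof (intro add_mono suminf_le)
    fix n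
    have "ennreal ((2 ^ Suc n) powr \<delta>) * emeasure U (A n) = ennreal ((2 ^ Suc n) powr \<delta> * measure U (A n))"
      by (simp add: emeasure_eq_measure ennreal_mult)
    also have "\<dots> \<le> ennreal ((2 ^ Suc n) powr \<delta> * (2 powr - \<epsilon>) ^ n)"
      using tail[of n] by (intro ennreal_leI mult_left_mono) (auto simp: A_def)
    also have "(2 ^ Suc n) powr \<delta> * (2 powr - \<epsilon>) ^ n = 2 powr \<delta> * r ^ n"
    proof -
      have "(2 ^ Suc n) powr \<delta> = 2 powr \<delta> * (2 powr \<delta>) ^ n"
        by (simp add: powr_mult powr_powr powr_realpow[symmetric] mult.commute)
      then show ?thesis
        by (simp add: r_def power_mult_distrib[symmetric] powr_diff powr_minus divide_inverse)
    qed
    finally show "ennreal ((2 ^ Suc n) powr \<delta>) * emeasure U (A n) \<le> ennreal (2 powr \<delta> * r ^ n)" .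
  qed auto
  also have "(\<Sum>n. ennreal (2 powr \<delta> * r ^ n)) = ennreal (2 powr \<delta> * (1 / (1 - r)))"
  proof (rule suminf_ennreal_eq)
    show "(\<lambda>n. 2 powr \<delta> * r ^ n) sums (2 powr \<delta> * (1 / (1 - r)))"
      using r by (intro sums_mult geometric_sums) auto
  qed (use r in auto)
  also have "1 + \<dots> = ennreal (1 + 2 powr \<delta> / (1 - r))"
    using r by (simp add: ennreal_plus)
  finally have bd: "(\<integral>\<^sup>+w. ennreal (Z w powr \<delta>) \<partial>U) \<le> ennreal (1 + 2 powr \<delta> / (1 - r))" .
  then show int: "integrable U (\<lambda>w. Z w powr \<delta>)"
    by (intro integrableI_nonneg) (auto simp: le_less_trans[OF _ ennreal_less_top])
  have "ennreal (LINT w|U. Z w powr \<delta>) \<le> ennreal (1 + 2 powr \<delta> / (1 - r))"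
    using bd nn_integral_eq_integral[OF int] by simp
  then show "(LINT w|U. Z w powr \<delta>) \<le> 1 + 2 powr \<delta> / (1 - 2 powr (\<delta> - \<epsilon>))"
    using r by (subst (asm) ennreal_le_iff) (auto simp: r_def)
qed

section \<open>Conditional laws of a regularly varying vector\<close>

lemma scaleR_image_eq: "c > 0 \<Longrightarrow> (*\<^sub>R) c ` B = {x. x /\<^sub>R c \<in> (B :: 'a::real_vector set)}"
  by (auto simp: image_iff intro!: bexI[of _ "_ /\<^sub>R c"])

lemma frontier_norm_gt: "frontier {x. c < norm x} = sphere (0 :: 'a::euclidean_space) c"
proof -
  have "{x::'a. c < norm x} = - cball 0 c" by auto
  then show ?thesis by (simp only: frontier_complement frontier_cball)
qed

text \<open>
  The assumption \<open>fin\<close> makes \<^const>\<open>P_lim\<close> a probability measure. It is also what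
  forces the spheres to be null sets, so that \<open>{x. 1 < norm x}\<close> is a continuity set of \<open>\<mu>\<close>.
\<close>

locale regularly_varying_tail = prob_space M
  for M :: "'w measure" and X :: "'w \<Rightarrow> 'a::euclidean_space"
    and b :: "real \<Rightarrow> real" and \<mu> :: "'a measure" and \<alpha> :: real +
  assumes X [measurable]: "X \<in> borel_measurable M"
    and reg_var: "regularly_varying M X b \<mu>"
    and \<alpha>_pos: "\<alpha> > 0"
    and homog: "homogeneous_measure \<mu> (- \<alpha>)"
    and fin: "emeasure \<mu> {x. 1 < norm x} \<noteq> \<infinity>"
begin

definition cond_meas :: "real \<Rightarrow> 'w measure" where
  "cond_meas t = uniform_measure M {w \<in> space M. t < norm (X w)}"

lemma space_cond_meas [simp]: "space (cond_meas t) = space M"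
  and sets_cond_meas [simp, measurable_cong]: "sets (cond_meas t) = sets M"
  by (simp_all add: cond_meas_def)

lemma sets_\<mu>: "sets \<mu> = sets (restrict_space borel (- {0}))"
  using reg_var by (simp add: regularly_varying_def)

lemma space_\<mu>: "space \<mu> = - {0}"
  using sets_eq_imp_space_eq[OF sets_\<mu>] by (simp add: space_restrict_space)

lemma in_sets_\<mu>: "A \<in> sets \<mu> \<longleftrightarrow> A \<in> sets borel \<and> 0 \<notin> A"
  unfolding sets_\<mu> by (subst sets_restrict_space_iff) auto

lemma borel_measurable_\<mu>: "f \<in> borel_measurable borel \<Longrightarrow> f \<in> borel_measurable \<mu>"
  unfolding measurable_cong_sets[OF sets_\<mu> refl] by (rule measurable_restrict_space1)

lemma emeasure_scaleR:
  "c > 0 \<Longrightarrow> B \<in> sets \<mu> \<Longrightarrow> emeasure \<mu> {x. x /\<^sub>R c \<in> B} = ennreal (c powr - \<alpha>) * emeasure \<mu> B"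
  using homog by (simp add: homogeneous_measure_def scaleR_image_eq)

lemma emeasure_norm_gt:
  assumes "c > 0"
  shows "emeasure \<mu> {x. c < norm x} = ennreal (c powr - \<alpha>) * emeasure \<mu> {x. 1 < norm x}"
proof -
  have "{x::'a. c < norm x} = {x. x /\<^sub>R c \<in> {x. 1 < norm x}}"
    using assms by (auto simp: divide_simps)
  then show ?thesis
    using emeasure_scaleR[OF assms, of "{x. 1 < norm x}"] by (simp add: in_sets_\<mu>)
qed

text \<open>
  By homogeneity all sets \<open>{x. c < norm x}\<close> with \<open>c > 0\<close> are null together, and countably many of them
  exhaust the punctured space, which has positive mass.
\<close>

lemma emeasure_norm_gt_1_nonzero: "emeasure \<mu> {x. 1 < norm x} \<noteq> 0"
proof
  assume "emeasure \<mu> {x. 1 < norm x} = 0"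
  then have "emeasure \<mu> (\<Union>n. {x. inverse (real (Suc n)) < norm x}) = 0"
    by (intro emeasure_UN_eq_0) (auto simp: in_sets_\<mu> emeasure_norm_gt[of "inverse (1 + real _)"])
  also have "(\<Union>n. {x. inverse (real (Suc n)) < norm x}) = space \<mu>"
  proof (intro set_eqI iffI)
    fix x :: 'a assume "x \<in> space \<mu>"
    then obtain n where "inverse (real (Suc n)) < norm x"
      using reals_Archimedean[of "norm x"] by (auto simp: space_\<mu>)
    then show "x \<in> (\<Union>n. {x. inverse (real (Suc n)) < norm x})" by blast
  qed (auto simp: space_\<mu>)
  finally show False
    using reg_var by (simp add: regularly_varying_def)
qed

lemma measure_norm_gt_1_pos: "0 < measure \<mu> {x. 1 < norm x}"
proof -
  have "0 < emeasure \<mu> {x. 1 < norm x}"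
    using emeasure_norm_gt_1_nonzero by (subst zero_less_iff_neq_zero)
  moreover have "emeasure \<mu> {x. 1 < norm x} < top"
    using fin by (subst less_top[symmetric]) simp
  ultimately show ?thesis
    unfolding measure_def enn2real_positive_iff by blast
qed

lemma prob_space_P_lim: "prob_space (P_lim \<mu>)"
  unfolding P_lim_def using emeasure_norm_gt_1_nonzero fin by (rule prob_space_uniform_measure)

lemma measurable_P_lim: "f \<in> borel_measurable borel \<Longrightarrow> f \<in> borel_measurable (P_lim \<mu>)"
  unfolding P_lim_def measurable_cong_sets[OF sets_uniform_measure refl] by (rule borel_measurable_\<mu>)

lemma space_P_lim: "space (P_lim \<mu>) = - {0}"
  by (simp add: P_lim_def space_\<mu>)

lemma measure_P_lim:
  assumes "B \<in> sets borel" "B \<subseteq> {x. 1 < norm x}"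
  shows "measure (P_lim \<mu>) B = measure \<mu> B / measure \<mu> {x. 1 < norm x}"
proof -
  have B: "B \<in> sets \<mu>" using assms(1) subsetD[OF assms(2), of 0] by (auto simp: in_sets_\<mu>)
  have "{x. 1 < norm x} \<inter> B = B" using assms(2) by blast
  then show ?thesis
    using measure_uniform_measure[OF emeasure_norm_gt_1_nonzero fin B] by (simp only: P_lim_def)
qed

lemma measure_P_lim_norm_gt:
  assumes "1 \<le> c"
  shows "measure (P_lim \<mu>) {x. c < norm x} = c powr - \<alpha>"
proof -
  have "measure \<mu> {x. c < norm x} = c powr - \<alpha> * measure \<mu> {x. 1 < norm x}"
    using assms emeasure_norm_gt[of c] by (simp only: measure_def enn2real_mult) simp
  moreover have "{x. c < norm x} \<subseteq> {x::'a. 1 < norm x}"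
    using assms by auto
  ultimately show ?thesis
    using measure_norm_gt_1_pos by (simp add: measure_P_lim)
qed

text \<open>
  By homogeneity, if one sphere has positive mass then so do all. But the uncountably many spheres
  of radius greater than 1 are disjoint, and the law of the norm under the probability measure
  \<^const>\<open>P_lim\<close> has only countably many atoms.
\<close>

lemma emeasure_sphere:
  assumes "r > 0"
  shows "emeasure \<mu> (sphere 0 r) = 0"
proof (rule ccontr)
  assume nz: "emeasure \<mu> (sphere 0 r) \<noteq> 0"
  interpret P: prob_space "P_lim \<mu>" by (rule prob_space_P_lim)
  have norm_meas: "norm \<in> borel_measurable (P_lim \<mu>)"
    by (rule measurable_P_lim) simp
  interpret D: prob_space "distr (P_lim \<mu>) borel norm"
    by (rule P.prob_space_distr[OF norm_meas])
  have "measure (distr (P_lim \<mu>) borel norm) {s} \<noteq> 0" if s: "s > 1" for s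
  proof -
    have eq: "{x::'a. x /\<^sub>R (s / r) \<in> sphere 0 r} = sphere 0 s"
      using s assms by (auto simp: field_simps)
    have "sphere 0 r \<in> sets \<mu>"
      using assms by (simp add: in_sets_\<mu>)
    from emeasure_scaleR[OF _ this, of "s / r"]
    have "emeasure \<mu> (sphere 0 s) = ennreal ((s / r) powr - \<alpha>) * emeasure \<mu> (sphere 0 r)"
      using s assms by (simp only: eq) simp
    moreover have "ennreal ((s / r) powr - \<alpha>) \<noteq> 0"
      using s assms by simp
    ultimately have "emeasure \<mu> (sphere 0 s) \<noteq> 0"
      using nz by simp
    moreover have "emeasure \<mu> (sphere 0 s) \<le> emeasure \<mu> {x. 1 < norm x}"
      using s by (intro emeasure_mono) (auto simp: in_sets_\<mu>)
    ultimately have "measure \<mu> (sphere 0 s) \<noteq> 0"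
      using fin unfolding measure_def enn2real_eq_0_iff by (metis infinity_ennreal_def top_unique)
    moreover have "measure (distr (P_lim \<mu>) borel norm) {s} = measure (P_lim \<mu>) (sphere 0 s)"
    proof -
      have "norm -` {s} \<inter> space (P_lim \<mu>) = sphere 0 s"
        using s by (auto simp: space_P_lim)
      then show ?thesis using measure_distr[OF norm_meas, of "{s}"] by simp
    qed
    moreover have "\<dots> = measure \<mu> (sphere 0 s) / measure \<mu> {x. 1 < norm x}"
      using s by (intro measure_P_lim) auto
    ultimately show ?thesis
      using measure_norm_gt_1_pos by simp
  qed
  then have "{1<..<2} \<subseteq> {s. measure (distr (P_lim \<mu>) borel norm) {s} \<noteq> 0}" by auto
  then have "countable {1<..<2::real}"
    using D.countable_support by (rule countable_subset)
  then show False
    using uncountable_open_interval[of 1 "2::real"] by simp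
qed

lemma emeasure_frontier_norm_gt: "c > 0 \<Longrightarrow> emeasure \<mu> (frontier {x. c < norm x}) = 0"
  by (simp add: frontier_norm_gt emeasure_sphere)

lemma rv_limit:
  assumes "B \<in> sets borel" "B \<subseteq> {x. 1 < norm x}" "emeasure \<mu> (frontier B) = 0"
  shows "((\<lambda>t. prob {w \<in> space M. X w /\<^sub>R t \<in> B} / b t) \<longlongrightarrow> measure \<mu> B) at_top"
proof -
  have "closure B \<subseteq> {x. 1 \<le> norm x}"
    using assms(2) by (intro closure_minimal closed_Collect_le continuous_intros) auto
  then have "0 \<notin> closure B" by auto
  then have "((\<lambda>t. prob {w \<in> space M. X w \<in> (*\<^sub>R) t ` B} / b t) \<longlongrightarrow> measure \<mu> B) at_top"
    using reg_var assms by (simp add: regularly_varying_def)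
  then show ?thesis
    by (rule Lim_transform_eventually)
       (auto intro!: eventually_mono[OF eventually_gt_at_top[of 0]] simp: scaleR_image_eq)
qed

lemma b_pos: "t > 0 \<Longrightarrow> b t > 0"
  using reg_var by (simp add: regularly_varying_def)

lemma norm_scaled_gt: "t > 0 \<Longrightarrow> c < norm (x /\<^sub>R t) \<longleftrightarrow> c * t < norm (x::'a)"
  by (simp add: field_simps)

lemma rv_limit_tail:
  "((\<lambda>t. prob {w \<in> space M. t < norm (X w)} / b t) \<longlongrightarrow> measure \<mu> {x. 1 < norm x}) at_top"
proof (rule Lim_transform_eventually[OF rv_limit[of "{x. 1 < norm x}"]])
  show "\<forall>\<^sub>F t in at_top. prob {w \<in> space M. X w /\<^sub>R t \<in> {x. 1 < norm x}} / b t =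
      prob {w \<in> space M. t < norm (X w)} / b t"
    by (rule eventually_mono[OF eventually_gt_at_top[of 0]]) (simp add: norm_scaled_gt del: norm_scaleR)
qed (auto simp: emeasure_frontier_norm_gt)

lemma eventually_tail_pos: "\<forall>\<^sub>F t in at_top. 0 < t \<and> 0 < prob {w \<in> space M. t < norm (X w)}"
  using order_tendstoD(1)[OF rv_limit_tail measure_norm_gt_1_pos] eventually_gt_at_top[of 0]
  by eventually_elim (auto simp: zero_less_divide_iff dest: b_pos)

lemma prob_space_cond_meas: "0 < prob {w \<in> space M. t < norm (X w)} \<Longrightarrow> prob_space (cond_meas t)"
  unfolding cond_meas_def by (intro prob_space_uniform_measure) (auto simp: emeasure_eq_measure)

lemma measure_cond_meas:
  assumes "0 < prob {w \<in> space M. t < norm (X w)}" "B \<in> events" "B \<subseteq> {w. t < norm (X w)}"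
  shows "measure (cond_meas t) B = prob B / prob {w \<in> space M. t < norm (X w)}"
proof -
  have "{w \<in> space M. t < norm (X w)} \<inter> B = B"
    using assms(2,3) sets.sets_into_space by blast
  then show ?thesis
    using assms unfolding cond_meas_def by (subst measure_uniform_measure) (auto simp: emeasure_eq_measure)
qed

text \<open>
  Both the numerator and the denominator of the conditional probability converge after division by
  \<open>b t\<close>, so the normalization cancels in the quotient.
\<close>

lemma conditional_prob_limit:
  assumes B [measurable]: "B \<in> sets borel" and "B \<subseteq> {x. 1 < norm x}" "emeasure \<mu> (frontier B) = 0"
  shows "((\<lambda>t. measure (cond_meas t) {w \<in> space M. X w /\<^sub>R t \<in> B}) \<longlongrightarrow> measure (P_lim \<mu>) B) at_top"
proof -
  have "((\<lambda>t. (prob {w \<in> space M. X w /\<^sub>R t \<in> B} / b t) / (prob {w \<in> space M. t < norm (X w)} / b t))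
      \<longlongrightarrow> measure \<mu> B / measure \<mu> {x. 1 < norm x}) at_top"
    using measure_norm_gt_1_pos by (intro tendsto_divide rv_limit assms rv_limit_tail) auto
  then have "((\<lambda>t. measure (cond_meas t) {w \<in> space M. X w /\<^sub>R t \<in> B})
      \<longlongrightarrow> measure \<mu> B / measure \<mu> {x. 1 < norm x}) at_top"
  proof (rule Lim_transform_eventually)
    show "\<forall>\<^sub>F t in at_top. (prob {w \<in> space M. X w /\<^sub>R t \<in> B} / b t) / (prob {w \<in> space M. t < norm (X w)} / b t)
        = measure (cond_meas t) {w \<in> space M. X w /\<^sub>R t \<in> B}"
      using eventually_tail_pos
    proof eventually_elim
      case (elim t)
      then have "{w \<in> space M. X w /\<^sub>R t \<in> B} \<subseteq> {w. t < norm (X w)}"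
        using assms(2) norm_scaled_gt[of t 1] by auto
      then show ?case
        using elim b_pos[of t] by (subst measure_cond_meas) auto
    qed
  qed
  then show ?thesis by (simp add: measure_P_lim assms)
qed

text \<open>
  For large \<open>t\<close> the tail shrinks by at least the factor \<open>2 powr - \<epsilon>\<close> when \<open>t\<close> is doubled, since the
  limiting factor \<open>2 powr - \<alpha>\<close> is strictly smaller. Iterating from any such \<open>t\<close> yields a bound that
  is uniform in \<open>t\<close>.
\<close>

lemma eventually_dyadic_tail:
  assumes "\<epsilon> < \<alpha>"
  shows "\<forall>\<^sub>F t in at_top. \<forall>n. measure (cond_meas t) {w \<in> space M. 2 ^ n < norm (X w /\<^sub>R t)} \<le> (2 powr - \<epsilon>) ^ n"
proof -
  define tail where "tail t = prob {w \<in> space M. t < norm (X w)}" for t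
  have sub: "{x::'a. 2 < norm x} \<subseteq> {x. 1 < norm x}" by auto
  have "measure (P_lim \<mu>) {x. 2 < norm x} = 2 powr - \<alpha>"
    by (rule measure_P_lim_norm_gt) simp
  then have "((\<lambda>t. measure (cond_meas t) {w \<in> space M. X w /\<^sub>R t \<in> {x. 2 < norm x}}) \<longlongrightarrow> 2 powr - \<alpha>) at_top"
    using conditional_prob_limit[OF _ sub] by (simp add: emeasure_frontier_norm_gt)
  then have "\<forall>\<^sub>F t in at_top. measure (cond_meas t) {w \<in> space M. X w /\<^sub>R t \<in> {x. 2 < norm x}} < 2 powr - \<epsilon>"
    using assms by (intro order_tendstoD(2)) auto
  then have "\<forall>\<^sub>F t in at_top. tail (2 * t) \<le> 2 powr - \<epsilon> * tail t"
    using eventually_tail_pos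
  proof eventually_elim
    case (elim t)
    then have "measure (cond_meas t) {w \<in> space M. X w /\<^sub>R t \<in> {x. 2 < norm x}} = tail (2 * t) / tail t"
      unfolding tail_def by (subst measure_cond_meas) (auto simp: norm_scaled_gt simp del: norm_scaleR)
    with elim show ?case
      by (simp add: tail_def divide_less_eq)
  qed
  then obtain t0 where t0: "\<And>t. t \<ge> t0 \<Longrightarrow> tail (2 * t) \<le> 2 powr - \<epsilon> * tail t"
    by (auto simp: eventually_at_top_linorder)
  have iter: "tail (2 ^ n * t) \<le> (2 powr - \<epsilon>) ^ n * tail t" if t: "t \<ge> max t0 0" for t n
  proof (induction n)
    case (Suc n)
    have "1 * t \<le> 2 ^ n * t" using t by (intro mult_right_mono) auto
    then have "tail (2 ^ Suc n * t) \<le> 2 powr - \<epsilon> * tail (2 ^ n * t)"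
      using t0[of "2 ^ n * t"] t by (simp add: mult.assoc)
    also have "\<dots> \<le> 2 powr - \<epsilon> * ((2 powr - \<epsilon>) ^ n * tail t)"
      using Suc by (intro mult_left_mono) auto
    finally show ?case by (simp add: mult.assoc)
  qed simp
  show ?thesis
    using eventually_tail_pos eventually_ge_at_top[of "max t0 0"]
  proof eventually_elim
    case (elim t)
    show ?case
    proof
      fix n
      have "1 * t \<le> 2 ^ n * t" using elim by (intro mult_right_mono) auto
      then have "{w \<in> space M. 2 ^ n * t < norm (X w)} \<subseteq> {w. t < norm (X w)}" by force
      then have "measure (cond_meas t) {w \<in> space M. 2 ^ n < norm (X w /\<^sub>R t)} = tail (2 ^ n * t) / tail t"
        using elim unfolding tail_def
        by (subst measure_cond_meas) (simp_all add: norm_scaled_gt del: norm_scaleR)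
      with iter[of t n] elim show "measure (cond_meas t) {w \<in> space M. 2 ^ n < norm (X w /\<^sub>R t)} \<le> (2 powr - \<epsilon>) ^ n"
        by (simp add: tail_def divide_le_eq)
    qed
  qed
qed

lemma moments_bounded:
  assumes "0 \<le> \<delta>" "\<delta> < \<alpha>"
  obtains B where
    "\<forall>\<^sub>F t in at_top. integrable (cond_meas t) (\<lambda>w. norm (X w /\<^sub>R t) powr \<delta>) \<and>
        (LINT w|cond_meas t. norm (X w /\<^sub>R t) powr \<delta>) \<le> B"
    "integrable (P_lim \<mu>) (\<lambda>x. norm x powr \<delta>)" "(LINT x|P_lim \<mu>. norm x powr \<delta>) \<le> B"
proof -
  \<comment> \<open>Any exponent strictly between the moment order and the tail index would do.\<close>
  define \<epsilon> where "\<epsilon> = (\<delta> + \<alpha>) / 2"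
  have \<epsilon>: "\<delta> < \<epsilon>" "\<epsilon> < \<alpha>" using assms by (auto simp: \<epsilon>_def)
  note bound = moment_bound_of_dyadic_tail[OF _ _ _ assms(1) \<epsilon>(1)]
  have tail_lim: "measure (P_lim \<mu>) {x \<in> space (P_lim \<mu>). 2 ^ n < norm x} \<le> (2 powr - \<epsilon>) ^ n" for n
  proof -
    have "{x \<in> space (P_lim \<mu>). 2 ^ n < norm x} = {x. 2 ^ n < norm x}"
      by (auto simp: space_P_lim not_less)
    then have "measure (P_lim \<mu>) {x \<in> space (P_lim \<mu>). 2 ^ n < norm x} = (2 ^ n) powr - \<alpha>"
      by (simp add: measure_P_lim_norm_gt)
    also have "\<dots> = (2 powr - \<alpha>) ^ n"
      by (simp add: powr_realpow[symmetric] powr_powr mult.commute)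
    also have "\<dots> \<le> (2 powr - \<epsilon>) ^ n"
      using \<epsilon> by (intro power_mono) auto
    finally show ?thesis .
  qed
  have "norm \<in> borel_measurable (P_lim \<mu>)"
    by (rule measurable_P_lim) measurable
  note lim = bound[OF prob_space_P_lim this norm_ge_zero tail_lim]
  have ev: "\<forall>\<^sub>F t in at_top. integrable (cond_meas t) (\<lambda>w. norm (X w /\<^sub>R t) powr \<delta>) \<and>
        (LINT w|cond_meas t. norm (X w /\<^sub>R t) powr \<delta>) \<le> 1 + 2 powr \<delta> / (1 - 2 powr (\<delta> - \<epsilon>))"
    using eventually_tail_pos eventually_dyadic_tail[OF \<epsilon>(2)]
  proof eventually_elim
    case (elim t)
    have "(\<lambda>w. norm (X w /\<^sub>R t)) \<in> borel_measurable (cond_meas t)" by measurable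
    with bound[OF prob_space_cond_meas this norm_ge_zero] elim show ?case by simp
  qed
  show ?thesis by (rule that[OF ev lim])
qed

lemma AE_\<mu>_norm_neq: "c > 0 \<Longrightarrow> AE x in \<mu>. norm x \<noteq> c"
  using emeasure_sphere[of c]
  by (intro AE_I[of _ _ "sphere 0 c"]) (auto simp: in_sets_\<mu>)

text \<open>
  Away from the unit sphere, a continuity point \<open>x\<close> of \<open>f\<close> with \<open>f x \<noteq> y\<close> has a neighbourhood on which
  membership in the sublevel set is constant. Hence the frontier lies in the union of the sphere, the level
  set and the discontinuities of \<open>f\<close>.
\<close>

lemma emeasure_frontier_sublevel:
  fixes f :: "'a \<Rightarrow> real"
  assumes f [measurable]: "f \<in> borel_measurable borel" and cont: "AE x in \<mu>. isCont f x"
    and null: "measure (P_lim \<mu>) {x. 1 < norm x \<and> f x = y} = 0"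
  shows "emeasure \<mu> (frontier {x. 1 < norm x \<and> f x \<le> y}) = 0"
proof -
  let ?F = "frontier {x. 1 < norm x \<and> f x \<le> y}" and ?E = "{x. 1 < norm x \<and> f x = y}"
  have "closure {x. 1 < norm x \<and> f x \<le> y} \<subseteq> {x. 1 \<le> norm x}"
    by (intro closure_minimal closed_Collect_le continuous_intros) auto
  then have F: "?F \<subseteq> {x. 1 \<le> norm x}" by (auto simp: frontier_def)
  then have F_sets: "?F \<in> sets \<mu>" by (auto simp: in_sets_\<mu> borel_closed)
  have E_sets: "?E \<in> sets \<mu>" by (auto simp: in_sets_\<mu>)
  have "emeasure \<mu> ?E \<le> emeasure \<mu> {x. 1 < norm x}"
    by (intro emeasure_mono) (auto simp: in_sets_\<mu>)
  moreover have "measure \<mu> ?E = 0"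
    using null measure_norm_gt_1_pos by (subst (asm) measure_P_lim) auto
  ultimately have "emeasure \<mu> ?E = 0"
    using fin by (auto simp: measure_def enn2real_eq_0_iff top_unique)
  then have "AE x in \<mu>. x \<notin> ?E"
    using E_sets by (intro AE_I[of _ _ ?E]) auto
  moreover have "AE x in \<mu>. norm x \<noteq> 1" by (rule AE_\<mu>_norm_neq) simp
  ultimately have "AE x in \<mu>. x \<notin> ?F"
    using cont
  proof eventually_elim
    case (elim x)
    show ?case
    proof
      assume xF: "x \<in> ?F"
      then have x: "1 < norm x" "f x \<noteq> y" using F elim by auto
      have ev: "\<forall>\<^sub>F z in nhds x. 1 < norm z"
        using order_tendstoD(1)[OF tendsto_norm[OF filterlim_ident] x(1)] .
      have lim: "(f \<longlongrightarrow> f x) (nhds x)"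
        using elim(3) by (simp add: isCont_def tendsto_at_iff_tendsto_nhds)
      show False
      proof (cases "f x < y")
        case True
        have "\<forall>\<^sub>F z in nhds x. z \<in> {x. 1 < norm x \<and> f x \<le> y}"
          using ev order_tendstoD(2)[OF lim True] by eventually_elim auto
        then have "x \<in> interior {x. 1 < norm x \<and> f x \<le> y}"
          by (metis (no_types, lifting) eventually_nhds interiorI subsetI)
        then show False using xF by (simp add: frontier_def)
      next
        case False
        then have "\<forall>\<^sub>F z in nhds x. z \<in> - {x. 1 < norm x \<and> f x \<le> y}"
          using order_tendstoD(1)[OF lim, of y] x by (auto elim!: eventually_mono)
        then have "x \<in> interior (- {x. 1 < norm x \<and> f x \<le> y})"
          by (metis (no_types, lifting) eventually_nhds interiorI subsetI)
        then show False using xF by (simp add: frontier_def interior_complement)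
      qed
    qed
  qed
  then show ?thesis
    using F_sets by (subst (asm) AE_iff_measurable[of ?F]) (auto simp: in_sets_\<mu> space_\<mu>)
qed

text \<open>
  The distribution function of \<open>f (X / t)\<close> at \<open>y\<close> is the conditional probability of a sublevel set of \<open>f\<close>.
  At a continuity point \<open>y\<close> of the limiting distribution function the level set is null, so that
  sublevel set is a continuity set of \<open>\<mu>\<close>.
\<close>

lemma conditional_law_weak_conv:
  fixes f :: "'a \<Rightarrow> real"
  assumes f [measurable]: "f \<in> borel_measurable borel" and cont: "AE x in \<mu>. isCont f x"
    and T: "filterlim T at_top sequentially" "\<And>n. 0 < T n" "\<And>n. 0 < prob {w \<in> space M. T n < norm (X w)}"
  shows "weak_conv_m (\<lambda>n. distr (cond_meas (T n)) borel (\<lambda>w. f (X w /\<^sub>R T n))) (distr (P_lim \<mu>) borel f)"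
  unfolding weak_conv_m_def weak_conv_def
proof (intro allI impI)
  fix y
  let ?N = "distr (P_lim \<mu>) borel f" and ?B = "{x. 1 < norm x \<and> f x \<le> y}"
  interpret P: prob_space "P_lim \<mu>" by (rule prob_space_P_lim)
  have fP [measurable]: "f \<in> borel_measurable (P_lim \<mu>)" by (rule measurable_P_lim) fact
  interpret N: real_distribution ?N by (rule P.real_distribution_distr) fact
  have AE_P: "AE x in P_lim \<mu>. 1 < norm x"
    unfolding P_lim_def by (rule AE_uniform_measureI) (auto simp: in_sets_\<mu>)
  \<comment> \<open>The limit law gives full mass to the complement of the unit ball, where regular variation applies.\<close>
  have restrict: "measure (P_lim \<mu>) {x \<in> space (P_lim \<mu>). Q (f x)} = measure (P_lim \<mu>) {x. 1 < norm x \<and> Q (f x)}"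
    if [measurable]: "Measurable.pred borel Q" for Q
  proof (rule P.finite_measure_eq_AE)
    show "AE x in P_lim \<mu>. (x \<in> {x \<in> space (P_lim \<mu>). Q (f x)}) = (x \<in> {x. 1 < norm x \<and> Q (f x)})"
      using AE_P by eventually_elim (auto simp: space_P_lim)
    show "{x \<in> space (P_lim \<mu>). Q (f x)} \<in> P.events" by measurable
    show "{x. 1 < norm x \<and> Q (f x)} \<in> P.events" by (auto simp: P_lim_def in_sets_\<mu>)
  qed
  assume "isCont (cdf ?N) y"
  then have "measure ?N {y} = 0" by (simp add: N.isCont_cdf)
  then have "measure (P_lim \<mu>) {x. 1 < norm x \<and> f x = y} = 0"
    using restrict[of "\<lambda>z. z = y"] by (simp add: measure_distr vimage_def Int_def conj_commute)
  then have "((\<lambda>t. measure (cond_meas t) {w \<in> space M. X w /\<^sub>R t \<in> ?B}) \<longlongrightarrow> measure (P_lim \<mu>) ?B) at_top"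
    using f cont by (intro conditional_prob_limit emeasure_frontier_sublevel) auto
  then have "(\<lambda>n. measure (cond_meas (T n)) {w \<in> space M. X w /\<^sub>R T n \<in> ?B}) \<longlonglongrightarrow> measure (P_lim \<mu>) ?B"
    using T(1) by (rule filterlim_compose)
  moreover have "measure (P_lim \<mu>) ?B = cdf ?N y"
    using restrict[of "\<lambda>z. z \<le> y"] by (simp add: cdf_def measure_distr vimage_def Int_def conj_commute)
  moreover have "measure (cond_meas (T n)) {w \<in> space M. X w /\<^sub>R T n \<in> ?B} =
      cdf (distr (cond_meas (T n)) borel (\<lambda>w. f (X w /\<^sub>R T n))) y" for n
  proof -
    interpret cond_meas: prob_space "cond_meas (T n)" by (rule prob_space_cond_meas[OF T(3)])
    have "AE w in cond_meas (T n). T n < norm (X w)"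
      unfolding cond_meas_def by (rule AE_uniform_measureI) auto
    then have "measure (cond_meas (T n)) {w \<in> space M. X w /\<^sub>R T n \<in> ?B} =
        measure (cond_meas (T n)) {w \<in> space M. f (X w /\<^sub>R T n) \<le> y}"
      using T(2)[of n] norm_scaled_gt[of "T n" 1]
      by (intro cond_meas.finite_measure_eq_AE) (auto simp del: norm_scaleR)
    then show ?thesis by (simp add: cdf_def measure_distr vimage_def Int_def conj_commute)
  qed
  ultimately show "(\<lambda>n. cdf (distr (cond_meas (T n)) borel (\<lambda>w. f (X w /\<^sub>R T n))) y) \<longlonglongrightarrow> cdf ?N y"
    by simp
qed

text \<open>
  Weak convergence extends to the unbounded \<open>f\<close>, since the growth condition
  leaves room for an exponent \<open>q > 1\<close> such that the moments of order \<open>q\<close> of \<open>f (X / t)\<close> are still bounded by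
  moments of \<open>norm (X / t)\<close> of order below \<open>\<alpha>\<close>.
\<close>

lemma conditional_expectation_limit:
  fixes f :: "'a \<Rightarrow> real"
  assumes f [measurable]: "f \<in> borel_measurable borel" and cont: "AE x in \<mu>. isCont f x"
    and \<gamma>: "0 \<le> \<gamma>" "\<gamma> < \<alpha>" and C: "0 \<le> C" and growth: "\<And>x. \<bar>f x\<bar> \<le> C * norm x powr \<gamma>"
  shows "((\<lambda>t. LINT w|cond_meas t. f (X w /\<^sub>R t)) \<longlongrightarrow> (LINT x|P_lim \<mu>. f x)) at_top"
proof (rule tendsto_at_topI_sequentially)
  fix T :: "nat \<Rightarrow> real" assume T: "filterlim T at_top sequentially"
  \<comment> \<open>The exponent must satisfy \<open>q > 1\<close> and \<open>\<gamma> * q < \<alpha>\<close>, also when \<open>\<gamma> = 0\<close>.\<close>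
  define q where "q = 2 * \<alpha> / (\<alpha> + \<gamma>)"
  have q: "1 < q" "0 \<le> \<gamma> * q" "\<gamma> * q < \<alpha>"
    using \<gamma> \<alpha>_pos by (auto simp: q_def field_simps)
  have pw: "\<bar>f x\<bar> powr q \<le> C powr q * norm x powr (\<gamma> * q)" for x
    using powr_mono2[OF _ _ growth[of x], of q] q C by (simp add: powr_mult powr_powr)
  from moments_bounded[OF q(2,3)] obtain B where
    B: "\<forall>\<^sub>F t in at_top. integrable (cond_meas t) (\<lambda>w. norm (X w /\<^sub>R t) powr (\<gamma> * q)) \<and>
        (LINT w|cond_meas t. norm (X w /\<^sub>R t) powr (\<gamma> * q)) \<le> B"
    and BP: "integrable (P_lim \<mu>) (\<lambda>x. norm x powr (\<gamma> * q))" "(LINT x|P_lim \<mu>. norm x powr (\<gamma> * q)) \<le> B"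
    by blast
  have mom: "integrable D (\<lambda>w. \<bar>f (Y w)\<bar> powr q) \<and> (LINT w|D. \<bar>f (Y w)\<bar> powr q) \<le> C powr q * B"
    if Y: "(\<lambda>w. f (Y w)) \<in> borel_measurable D" and i: "integrable D (\<lambda>w. norm (Y w) powr (\<gamma> * q))"
      and le: "(LINT w|D. norm (Y w) powr (\<gamma> * q)) \<le> B" for D :: "'z measure" and Y
  proof -
    have int: "integrable D (\<lambda>w. \<bar>f (Y w)\<bar> powr q)"
      using Y pw by (intro Bochner_Integration.integrable_bound[OF integrable_mult_right[OF i, of "C powr q"]]) auto
    have "(LINT w|D. \<bar>f (Y w)\<bar> powr q) \<le> (LINT w|D. C powr q * norm (Y w) powr (\<gamma> * q))"
      using int i pw by (intro integral_mono) auto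
    also have "\<dots> \<le> C powr q * B" using le by (auto intro: mult_left_mono)
    finally show ?thesis using int by blast
  qed
  obtain n0 where n0: "\<And>n. n \<ge> n0 \<Longrightarrow> 0 < T n \<and> 0 < prob {w \<in> space M. T n < norm (X w)} \<and>
      integrable (cond_meas (T n)) (\<lambda>w. norm (X w /\<^sub>R T n) powr (\<gamma> * q)) \<and>
      (LINT w|cond_meas (T n). norm (X w /\<^sub>R T n) powr (\<gamma> * q)) \<le> B"
    using eventually_compose_filterlim[OF eventually_conj[OF eventually_tail_pos B] T]
    by (auto simp: eventually_sequentially)
  \<comment> \<open>The moment bounds hold only for large \<open>t\<close>, whereas the weak convergence argument needs them for
    every index; dropping the first terms does not affect the limit.\<close>
  define S where "S n = T (n + n0)" for n
  have S: "0 < S n" "0 < prob {w \<in> space M. S n < norm (X w)}"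
    "integrable (cond_meas (S n)) (\<lambda>w. norm (X w /\<^sub>R S n) powr (\<gamma> * q))"
    "(LINT w|cond_meas (S n). norm (X w /\<^sub>R S n) powr (\<gamma> * q)) \<le> B" for n
    using n0[of "n + n0"] by (auto simp: S_def)
  have S_lim: "filterlim S at_top sequentially"
    unfolding S_def using T by (rule filterlim_compose) (rule filterlim_add_const_nat_at_top)
  define \<nu> where "\<nu> n = distr (cond_meas (S n)) borel (\<lambda>w. f (X w /\<^sub>R S n))" for n
  define N where "N = distr (P_lim \<mu>) borel f"
  have fP [measurable]: "f \<in> borel_measurable (P_lim \<mu>)" by (rule measurable_P_lim) fact
  have "(\<lambda>n. LINT y|\<nu> n. y) \<longlonglongrightarrow> (LINT y|N. y)"
  proof (rule weak_conv_integral_bounded_moments[where q = q and B = "C powr q * B"])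
    show "weak_conv_m \<nu> N"
      unfolding \<nu>_def N_def by (rule conditional_law_weak_conv[OF f cont S_lim S(1,2)])
    show "real_distribution (\<nu> n)" for n
      unfolding \<nu>_def by (intro prob_space.real_distribution_distr prob_space_cond_meas S) measurable
    show "real_distribution N"
      unfolding N_def by (intro prob_space.real_distribution_distr prob_space_P_lim fP)
    show "integrable (\<nu> n) (\<lambda>y. \<bar>y\<bar> powr q)" "(LINT y|\<nu> n. \<bar>y\<bar> powr q) \<le> C powr q * B" for n
      using mom[of "\<lambda>w. X w /\<^sub>R S n" "cond_meas (S n)"] S(3,4)[of n]
      by (simp_all add: \<nu>_def integrable_distr_eq integral_distr)
    show "integrable N (\<lambda>y. \<bar>y\<bar> powr q)" "(LINT y|N. \<bar>y\<bar> powr q) \<le> C powr q * B"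
      using mom[of "\<lambda>x. x" "P_lim \<mu>"] BP
      by (simp_all add: N_def integrable_distr_eq integral_distr)
  qed (rule q)
  then have "(\<lambda>n. LINT w|cond_meas (T (n + n0)). f (X w /\<^sub>R T (n + n0))) \<longlonglongrightarrow> (LINT x|P_lim \<mu>. f x)"
    by (simp add: \<nu>_def N_def integral_distr S_def)
  then show "(\<lambda>n. LINT w|cond_meas (T n). f (X w /\<^sub>R T n)) \<longlonglongrightarrow> (LINT x|P_lim \<mu>. f x)"
    by (rule LIMSEQ_offset)
qed

end

section \<open>The reconstruction error as a function of the subspace\<close>

definition residual :: "('a::euclidean_space \<Rightarrow> real) \<Rightarrow> 'a set \<Rightarrow> 'a \<Rightarrow> real" where
  "residual \<omega> W x = (norm (orth_proj (orthogonal_comp W) (rescale \<omega> x)))\<^sup>2"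

lemma risk_eq_residual: "risk Q \<omega> W = (LINT x|Q. residual \<omega> W x)"
  by (simp add: risk_def residual_def)

lemma residual_nonneg: "0 \<le> residual \<omega> W x"
  by (simp add: residual_def)

lemma residual_le: "residual \<omega> W x \<le> (norm (rescale \<omega> x))\<^sup>2"
  unfolding residual_def
  by (intro power_mono norm_orth_proj_le subspace_orthogonal_comp norm_ge_zero)

text \<open>
  Factor the difference of squares: the residual lengths differ by at most the operator norm times
  the length of the vector, and their sum is at most twice that length.
\<close>

lemma residual_diff_le:
  assumes "subspace V" "subspace W"
  shows "\<bar>residual \<omega> V x - residual \<omega> W x\<bar>
    \<le> 2 * norm (proj_blinfun V - proj_blinfun W) * (norm (rescale \<omega> x))\<^sup>2"
proof -
  define y where "y = rescale \<omega> x"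
  define u where "u = norm (orth_proj (orthogonal_comp V) y)"
  define v where "v = norm (orth_proj (orthogonal_comp W) y)"
  have "u \<le> norm y" "v \<le> norm y" "0 \<le> u" "0 \<le> v"
    by (auto simp: u_def v_def intro!: norm_orth_proj_le subspace_orthogonal_comp)
  have "\<bar>u - v\<bar> \<le> norm (orth_proj (orthogonal_comp V) y - orth_proj (orthogonal_comp W) y)"
    unfolding u_def v_def by (rule norm_triangle_ineq3)
  also have "\<dots> = norm (orth_proj V y - orth_proj W y)"
    by (simp add: orth_proj_orthogonal_comp assms norm_minus_commute)
  also have "\<dots> \<le> norm (proj_blinfun V - proj_blinfun W) * norm y"
    by (rule norm_orth_proj_diff_le[OF assms])
  finally have uv: "\<bar>u - v\<bar> \<le> norm (proj_blinfun V - proj_blinfun W) * norm y" .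
  have "\<bar>u\<^sup>2 - v\<^sup>2\<bar> = \<bar>u - v\<bar> * (u + v)"
    using \<open>0 \<le> u\<close> \<open>0 \<le> v\<close> by (simp add: power2_eq_square square_diff_square_factored abs_mult mult.commute)
  also have "\<dots> \<le> (norm (proj_blinfun V - proj_blinfun W) * norm y) * (2 * norm y)"
    using uv \<open>u \<le> norm y\<close> \<open>v \<le> norm y\<close> \<open>0 \<le> u\<close> \<open>0 \<le> v\<close> by (intro mult_mono) auto
  finally show ?thesis
    by (simp add: residual_def u_def v_def y_def power2_eq_square algebra_simps)
qed

lemma continuous_orth_proj: "subspace V \<Longrightarrow> isCont f x \<Longrightarrow> isCont (\<lambda>x. orth_proj V (f x)) x"
  using bounded_linear.isCont[OF bounded_linear_orth_proj] by blast

lemma borel_measurable_orth_proj: "subspace V \<Longrightarrow> orth_proj V \<in> borel_measurable borel"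
  by (intro borel_measurable_continuous_onI linear_continuous_on bounded_linear_orth_proj)

lemma borel_measurable_rescale:
  fixes \<omega> :: "'a::euclidean_space \<Rightarrow> real"
  assumes "\<omega> \<in> borel_measurable (restrict_space borel (- {0}))"
  shows "rescale \<omega> \<in> borel_measurable borel"
proof -
  have "(\<lambda>x. if x \<in> - {0} then \<omega> x *\<^sub>R x else 0) \<in> borel_measurable borel"
  proof (rule measurable_If_restrict_space_iff[THEN iffD2], goal_cases)
    case 2
    have "(\<lambda>x. \<omega> x *\<^sub>R x) \<in> borel_measurable (restrict_space borel (- {0}))"
      using assms measurable_ident
      by (intro borel_measurable_scaleR measurable_restrict_space1[of "\<lambda>x. x"]) (simp_all add: id_def)
    then show ?case by (simp only: Collect_mem_eq) simp
  qed auto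
  also have "(\<lambda>x. if x \<in> - {0} then \<omega> x *\<^sub>R x else 0) = rescale \<omega>"
    by (auto simp: rescale_def)
  finally show ?thesis .
qed

lemma borel_measurable_residual:
  assumes "\<omega> \<in> borel_measurable (restrict_space borel (- {0}))"
  shows "residual \<omega> W \<in> borel_measurable borel"
  unfolding residual_def
  using measurable_compose[OF borel_measurable_rescale[OF assms] borel_measurable_orth_proj[OF subspace_orthogonal_comp]]
  by measurable

text \<open>
  The case distinction in \<^const>\<open>rescale\<close> is invisible near \<open>x \<noteq> 0\<close>.
\<close>

lemma isCont_rescale:
  assumes "isCont \<omega> x" "x \<noteq> 0"
  shows "isCont (rescale \<omega>) x"
proof -
  have "isCont (\<lambda>x. \<omega> x *\<^sub>R x) x"
    using assms(1) by (intro continuous_intros)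
  moreover have "\<forall>\<^sub>F y in nhds x. rescale \<omega> y = \<omega> y *\<^sub>R y"
    using t1_space_nhds[OF assms(2)] by eventually_elim (simp add: rescale_def)
  ultimately show ?thesis by (simp add: isCont_cong)
qed

lemma isCont_residual:
  assumes "isCont \<omega> x" "x \<noteq> 0"
  shows "isCont (residual \<omega> W) x"
  unfolding residual_def
  by (intro continuous_intros continuous_orth_proj subspace_orthogonal_comp isCont_rescale assms)

locale homogeneous_scaling =
  fixes \<omega> :: "'a::euclidean_space \<Rightarrow> real" and \<beta> C :: real
  assumes \<omega>_pos: "x \<noteq> 0 \<Longrightarrow> 0 < \<omega> x"
    and \<omega>_hom: "0 < c \<Longrightarrow> x \<noteq> 0 \<Longrightarrow> \<omega> (c *\<^sub>R x) = c powr - \<beta> * \<omega> x"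
    and \<omega>_le: "norm x = 1 \<Longrightarrow> \<omega> x \<le> C"
begin

lemma rescale_scaleR:
  assumes "0 < c" shows "rescale \<omega> (c *\<^sub>R x) = c powr (1 - \<beta>) *\<^sub>R rescale \<omega> x"
  using assms by (auto simp: rescale_def \<omega>_hom powr_diff powr_minus divide_inverse)

text \<open>
  Homogeneity transfers the bound from the unit vector \<open>sgn x\<close> to \<open>x\<close>.
\<close>

lemma norm_rescale_le: "norm (rescale \<omega> x) \<le> C * norm x powr (1 - \<beta>)"
proof (cases "x = 0")
  case False
  then have "norm (sgn x) = 1" by (simp add: norm_sgn)
  moreover from this have "sgn x \<noteq> 0" by force
  ultimately have "norm (rescale \<omega> (sgn x)) \<le> C"
    using \<omega>_le[of "sgn x"] \<omega>_pos[of "sgn x"] by (simp add: rescale_def)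
  moreover have "x = norm x *\<^sub>R sgn x" using False by (simp add: sgn_div_norm)
  then have "norm (rescale \<omega> x) = norm x powr (1 - \<beta>) * norm (rescale \<omega> (sgn x))"
    using rescale_scaleR[of "norm x" "sgn x"] False by simp
  ultimately show ?thesis by (simp add: mult.commute mult_right_mono)
qed (simp add: rescale_def)

lemma norm_rescale_power2_le: "(norm (rescale \<omega> x))\<^sup>2 \<le> C\<^sup>2 * norm x powr (2 * (1 - \<beta>))"
proof -
  have "(norm (rescale \<omega> x))\<^sup>2 \<le> (C * norm x powr (1 - \<beta>))\<^sup>2"
    by (intro power_mono norm_rescale_le norm_ge_zero)
  also have "\<dots> = C\<^sup>2 * norm x powr (2 * (1 - \<beta>))"
    by (simp add: power2_eq_square powr_add[symmetric])
  finally show ?thesis .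
qed

lemma residual_scaleR:
  assumes "0 < c" shows "residual \<omega> W (c *\<^sub>R x) = c powr (2 * (1 - \<beta>)) * residual \<omega> W x"
proof -
  have "(c powr (1 - \<beta>))\<^sup>2 = c powr (2 * (1 - \<beta>))"
    by (simp add: power2_eq_square powr_add[symmetric])
  then show ?thesis
    using assms by (simp add: residual_def rescale_scaleR orth_proj_scaleR subspace_orthogonal_comp power_mult_distrib)
qed

end

section \<open>Convergence of the risks and of their minimizers\<close>

locale extremal_pca =
  regularly_varying_tail M X b \<mu> \<alpha> + homogeneous_scaling \<omega> \<beta> C
  for M :: "'w measure" and X :: "'w \<Rightarrow> 'a::euclidean_space" and b \<mu> \<alpha> \<omega> \<beta> C +
  assumes \<omega>_meas: "\<omega> \<in> borel_measurable (restrict_space borel (- {0}))"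
    and \<omega>_cont: "AE x in \<mu>. isCont \<omega> x"
    and \<beta>: "1 - \<alpha> / 2 < \<beta>" "\<beta> \<le> 1"
begin

text \<open>
  The risk at level \<open>t\<close> without its deterministic factor, which diverges if \<open>\<beta> < 1\<close>.
\<close>

definition scaled_risk :: "real \<Rightarrow> 'a set \<Rightarrow> real" where
  "scaled_risk t W = (LINT w|cond_meas t. residual \<omega> W (X w /\<^sub>R t))"

lemma risk_P_cond:
  assumes "0 < t"
  shows "risk (P_cond M X t) \<omega> W = t powr (2 * (1 - \<beta>)) * scaled_risk t W"
proof -
  have "risk (P_cond M X t) \<omega> W = (LINT w|cond_meas t. residual \<omega> W (X w))"
    unfolding risk_eq_residual P_cond_def cond_meas_def[symmetric]
    using borel_measurable_residual[OF \<omega>_meas] by (subst integral_distr) auto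
  also have "\<dots> = (LINT w|cond_meas t. t powr (2 * (1 - \<beta>)) * residual \<omega> W (X w /\<^sub>R t))"
  proof (rule Bochner_Integration.integral_cong[OF refl])
    show "residual \<omega> W (X w) = t powr (2 * (1 - \<beta>)) * residual \<omega> W (X w /\<^sub>R t)" for w
      using residual_scaleR[OF assms, of W "X w /\<^sub>R t"] assms by (simp only: scaleR_scaleR) simp
  qed
  finally show ?thesis by (simp add: scaled_risk_def)
qed

lemma scaled_risk_limit: "((\<lambda>t. scaled_risk t W) \<longlongrightarrow> risk (P_lim \<mu>) \<omega> W) at_top"
  unfolding scaled_risk_def risk_eq_residual
proof (rule conditional_expectation_limit)
  have "AE x in \<mu>. x \<noteq> 0"
    using AE_space by eventually_elim (simp add: space_\<mu>)
  with \<omega>_cont show "AE x in \<mu>. isCont (residual \<omega> W) x"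
    by eventually_elim (rule isCont_residual)
  show "\<bar>residual \<omega> W x\<bar> \<le> C\<^sup>2 * norm x powr (2 * (1 - \<beta>))" for x
    using residual_nonneg[of \<omega> W x] residual_le[of \<omega> W x] norm_rescale_power2_le[of x] by linarith
qed (use \<beta> borel_measurable_residual[OF \<omega>_meas] in \<open>auto simp: field_simps\<close>)

text \<open>
  The pointwise estimate \<open>residual_diff_le\<close> is integrated; the order \<open>2 * (1 - \<beta>)\<close> of the resulting
  moment lies below \<open>\<alpha>\<close>, so the Lipschitz constant does not depend on \<open>t\<close>. This is what allows the
  subspace to vary with \<open>t\<close>.
\<close>

lemma scaled_risk_lipschitz:
  obtains K where "\<forall>\<^sub>F t in at_top. \<forall>V W. subspace V \<longrightarrow> subspace W \<longrightarrow>
    \<bar>scaled_risk t V - scaled_risk t W\<bar> \<le> K * norm (proj_blinfun V - proj_blinfun W)"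
proof -
  let ?m = "\<lambda>t w. norm (X w /\<^sub>R t) powr (2 * (1 - \<beta>))"
  have "0 \<le> 2 * (1 - \<beta>)" "2 * (1 - \<beta>) < \<alpha>" using \<beta> by (auto simp: field_simps)
  from moments_bounded[OF this] obtain B where
    B: "\<forall>\<^sub>F t in at_top. integrable (cond_meas t) (?m t) \<and> (LINT w|cond_meas t. ?m t w) \<le> B"
    by blast
  have "\<forall>\<^sub>F t in at_top. \<forall>V W. subspace V \<longrightarrow> subspace W \<longrightarrow>
    \<bar>scaled_risk t V - scaled_risk t W\<bar> \<le> (2 * C\<^sup>2 * B) * norm (proj_blinfun V - proj_blinfun W)"
    using B
  proof eventually_elim
    case (elim t)
    have int: "integrable (cond_meas t) (\<lambda>w. residual \<omega> W (X w /\<^sub>R t))" for W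
    proof (rule Bochner_Integration.integrable_bound)
      show "integrable (cond_meas t) (\<lambda>w. C\<^sup>2 * ?m t w)" using elim by simp
      show "(\<lambda>w. residual \<omega> W (X w /\<^sub>R t)) \<in> borel_measurable (cond_meas t)"
        using measurable_compose[OF _ borel_measurable_residual[OF \<omega>_meas]] by measurable
      show "AE w in cond_meas t. norm (residual \<omega> W (X w /\<^sub>R t)) \<le> norm (C\<^sup>2 * ?m t w)"
        using residual_nonneg[of \<omega> W] order_trans[OF residual_le norm_rescale_power2_le]
        by (intro AE_I2) (simp add: abs_of_nonneg del: norm_scaleR)
    qed
    show ?case
    proof (intro allI impI)
      fix V W :: "'a set" assume VW: "subspace V" "subspace W"
      let ?d = "norm (proj_blinfun V - proj_blinfun W)"
      have "\<bar>residual \<omega> V x - residual \<omega> W x\<bar> \<le> 2 * ?d * (C\<^sup>2 * norm x powr (2 * (1 - \<beta>)))" for x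
        using residual_diff_le[OF VW] mult_left_mono[OF norm_rescale_power2_le]
        by (rule order_trans) simp
      then have "(LINT w|cond_meas t. \<bar>residual \<omega> V (X w /\<^sub>R t) - residual \<omega> W (X w /\<^sub>R t)\<bar>)
          \<le> (LINT w|cond_meas t. 2 * ?d * (C\<^sup>2 * ?m t w))"
        using elim int by (intro integral_mono) (simp_all del: norm_scaleR)
      also have "\<dots> = (2 * ?d * C\<^sup>2) * (LINT w|cond_meas t. ?m t w)"
        by (simp add: mult.assoc)
      also have "\<dots> \<le> (2 * ?d * C\<^sup>2) * B"
        using elim by (intro mult_left_mono) auto
      finally have "(LINT w|cond_meas t. \<bar>residual \<omega> V (X w /\<^sub>R t) - residual \<omega> W (X w /\<^sub>R t)\<bar>) \<le> 2 * C\<^sup>2 * B * ?d"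
        by (simp add: mult_ac)
      moreover have "\<bar>scaled_risk t V - scaled_risk t W\<bar>
          \<le> (LINT w|cond_meas t. \<bar>residual \<omega> V (X w /\<^sub>R t) - residual \<omega> W (X w /\<^sub>R t)\<bar>)"
        unfolding scaled_risk_def
        by (subst Bochner_Integration.integral_diff[symmetric, OF int int]) (rule integral_abs_bound)
      ultimately show "\<bar>scaled_risk t V - scaled_risk t W\<bar> \<le> 2 * C\<^sup>2 * B * ?d" by simp
    qed
  qed
  then show ?thesis by (rule that)
qed

lemma minimizers_converge:
  assumes unique: "\<And>W. is_arg_min (risk (P_lim \<mu>) \<omega>) (\<lambda>W. W \<in> subspaces_dim p) W \<Longrightarrow> W = V_inf"
    and V_inf: "V_inf \<in> subspaces_dim p"
    and V: "\<And>t. t > 0 \<Longrightarrow> is_arg_min (risk (P_cond M X t) \<omega>) (\<lambda>W. W \<in> subspaces_dim p) (V t)"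
    and min: "\<And>W. W \<in> subspaces_dim p \<Longrightarrow> risk (P_lim \<mu>) \<omega> V_inf \<le> risk (P_lim \<mu>) \<omega> W"
  shows "((\<lambda>t. norm (proj_blinfun (V t) - proj_blinfun V_inf)) \<longlongrightarrow> 0) at_top"
proof (rule ccontr)
  let ?g = "\<lambda>t. norm (proj_blinfun (V t) - proj_blinfun V_inf)"
  assume "\<not> (?g \<longlongrightarrow> 0) at_top"
  then obtain e where e: "e > 0" "\<not> (\<forall>\<^sub>F t in at_top. ?g t < e)"
    by (auto simp: tendsto_iff)
  have "\<exists>t. t \<ge> real (Suc n) \<and> ?g t \<ge> e" for n
    using e(2) by (force simp: eventually_at_top_linorder not_less)
  then obtain T where T: "\<And>n. T n \<ge> real (Suc n)" "\<And>n. ?g (T n) \<ge> e"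
    by metis
  have T_pos: "T n > 0" for n using T(1)[of n] by linarith
  have "V (T n) \<in> subspaces_dim p" for n
    using V[OF T_pos] by (simp add: is_arg_min_def)
  then obtain r W where r: "strict_mono r" and W: "W \<in> subspaces_dim p"
    and lim: "(\<lambda>n. proj_blinfun (V (T (r n)))) \<longlonglongrightarrow> proj_blinfun W"
    using subspaces_dim_sequentially_compact[of "\<lambda>n. V (T n)" p] by blast
  define \<tau> where "\<tau> n = T (r n)" for n
  have \<tau>_pos: "\<tau> n > 0" for n using T_pos by (simp add: \<tau>_def)
  have "filterlim T at_top sequentially"
  proof (rule filterlim_at_top_mono[OF filterlim_real_sequentially], intro always_eventually allI)
    show "real n \<le> T n" for n using T(1)[of n] by linarith
  qed
  then have \<tau>: "filterlim \<tau> at_top sequentially"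
    unfolding \<tau>_def using filterlim_subseq[OF r] by (rule filterlim_compose)
  obtain K where K: "\<forall>\<^sub>F t in at_top. \<forall>V W. subspace V \<longrightarrow> subspace W \<longrightarrow>
    \<bar>scaled_risk t V - scaled_risk t W\<bar> \<le> K * norm (proj_blinfun V - proj_blinfun W)"
    by (rule scaled_risk_lipschitz)
  have opt: "scaled_risk t (V t) \<le> scaled_risk t V_inf" if "t > 0" for t
    using V[OF that] V_inf that by (auto simp: is_arg_min_def risk_P_cond not_less)
  \<comment> \<open>Replacing the minimizer by its limit \<open>W\<close> costs only the distance of the projections.\<close>
  have le: "\<forall>\<^sub>F n in sequentially. scaled_risk (\<tau> n) W
      \<le> scaled_risk (\<tau> n) V_inf + K * norm (proj_blinfun (V (\<tau> n)) - proj_blinfun W)"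
    using eventually_compose_filterlim[OF K \<tau>]
  proof eventually_elim
    case (elim n)
    have "subspace (V (\<tau> n))" "subspace W"
      using V[OF \<tau>_pos[of n]] W by (simp_all add: is_arg_min_def subspaces_dim_def)
    from elim[rule_format, OF this] show ?case
      using opt[OF \<tau>_pos[of n]] by linarith
  qed
  have lim_W: "(\<lambda>n. scaled_risk (\<tau> n) W) \<longlonglongrightarrow> risk (P_lim \<mu>) \<omega> W"
    using scaled_risk_limit \<tau> by (rule filterlim_compose)
  have lim_V: "(\<lambda>n. scaled_risk (\<tau> n) V_inf + K * norm (proj_blinfun (V (\<tau> n)) - proj_blinfun W))
      \<longlonglongrightarrow> risk (P_lim \<mu>) \<omega> V_inf + K * norm (proj_blinfun W - proj_blinfun W)"
    using lim unfolding \<tau>_def[symmetric]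
    by (intro tendsto_intros filterlim_compose[OF scaled_risk_limit \<tau>])
  have "risk (P_lim \<mu>) \<omega> W \<le> risk (P_lim \<mu>) \<omega> V_inf + K * norm (proj_blinfun W - proj_blinfun W)"
    by (rule tendsto_le[OF sequentially_bot lim_V lim_W le])
  then have "risk (P_lim \<mu>) \<omega> W \<le> risk (P_lim \<mu>) \<omega> W'" if "W' \<in> subspaces_dim p" for W'
    using min[OF that] by simp
  then have "W = V_inf"
    using W by (intro unique) (simp add: is_arg_min_def not_less)
  moreover have "(\<lambda>n. ?g (T (r n))) \<longlonglongrightarrow> norm (proj_blinfun W - proj_blinfun V_inf)"
    using lim by (intro tendsto_intros)
  ultimately have "(\<lambda>n. ?g (T (r n))) \<longlonglongrightarrow> 0" by simp
  then have "e \<le> 0"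
    by (rule LIMSEQ_le_const) (use T(2) in auto)
  with e(1) show False by simp
qed

end

text \<open>
  Conditioning on a set of infinite mass divides by infinity and yields the zero measure.
\<close>

lemma risk_P_lim_infinite_tail:
  assumes "emeasure \<mu> {x. 1 < norm x} = \<infinity>"
  shows "risk (P_lim \<mu>) \<omega> W = 0"
proof -
  have "P_lim \<mu> = null_measure \<mu>"
    using assms by (simp add: P_lim_def uniform_measure_def null_measure_eq_density)
  then show ?thesis by (simp add: risk_def)
qed

theorem theorem2p5:
  fixes M :: "'w measure"
    and X :: "'w \<Rightarrow> real ^ 'd"
    and b :: "real \<Rightarrow> real"
    and \<mu> :: "(real ^ 'd) measure"
    and \<omega> :: "real ^ 'd \<Rightarrow> real"
    and \<alpha> :: real
    and p :: nat
    and V :: "real \<Rightarrow> (real ^ 'd) set"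
    and V_inf :: "(real ^ 'd) set"
  assumes "prob_space M"
    and "X \<in> borel_measurable M"
    and "regularly_varying M X b \<mu>"
    and "\<alpha> > 0" and "homogeneous_measure \<mu> (- \<alpha>)"
    and "\<omega> \<in> borel_measurable (restrict_space borel (- {0}))"
    and "\<forall>x. x \<noteq> 0 \<longrightarrow> \<omega> x > 0"
    and "AE x in \<mu>. isCont \<omega> x"
    and "\<exists>\<beta>. 1 - \<alpha> / 2 < \<beta> \<and> \<beta> \<le> 1 \<and>
           (\<forall>c>0. \<forall>x. x \<noteq> 0 \<longrightarrow> \<omega> (c *\<^sub>R x) = c powr (- \<beta>) * \<omega> x)"
    and "bdd_above (\<omega> ` sphere 0 1)"
    and "1 \<le> p" and "p \<le> CARD('d)"
    and "is_arg_min (risk (P_lim \<mu>) \<omega>) (\<lambda>W. W \<in> subspaces_dim p) V_inf"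
    and "\<forall>W. is_arg_min (risk (P_lim \<mu>) \<omega>) (\<lambda>W. W \<in> subspaces_dim p) W \<longrightarrow> W = V_inf"
    and "\<forall>t>0. is_arg_min (risk (P_cond M X t) \<omega>) (\<lambda>W. W \<in> subspaces_dim p) (V t)"
  shows "((\<lambda>t. subspace_dist (V t) V_inf) \<longlongrightarrow> 0) at_top"
proof -
  have V_inf: "V_inf \<in> subspaces_dim p"
    using assms(13) by (simp add: is_arg_min_def)
  have V: "V t \<in> subspaces_dim p" if "t > 0" for t
    using assms(15) that by (simp add: is_arg_min_def)
  have lim: "((\<lambda>t. norm (proj_blinfun (V t) - proj_blinfun V_inf)) \<longlongrightarrow> 0) at_top"
  proof (cases "emeasure \<mu> {x. 1 < norm x} = \<infinity>")
    case True
    \<comment> \<open>All limiting risks vanish, so by uniqueness \<open>V_inf\<close> is the only subspace of dimension \<open>p\<close>.\<close>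
    then have "V t = V_inf" if "t > 0" for t
      using assms(14) V[OF that] by (simp add: is_arg_min_def risk_P_lim_infinite_tail)
    then show ?thesis
      by (intro tendsto_eventually eventually_mono[OF eventually_gt_at_top[of 0]]) simp
  next
    case False
    obtain \<beta> where \<beta>: "1 - \<alpha> / 2 < \<beta>" "\<beta> \<le> 1"
      "\<And>c x. c > 0 \<Longrightarrow> x \<noteq> 0 \<Longrightarrow> \<omega> (c *\<^sub>R x) = c powr (- \<beta>) * \<omega> x"
      using assms(9) by blast
    obtain C where C: "\<And>x. norm x = 1 \<Longrightarrow> \<omega> x \<le> C"
      using assms(10) by (force simp: bdd_above_def)
    interpret prob_space M by fact
    interpret extremal_pca M X b \<mu> \<alpha> \<omega> \<beta> C
      by unfold_locales (fact assms False \<beta> C | use assms(7) in blast)+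
    show ?thesis
    proof (rule minimizers_converge[OF _ V_inf])
      show "risk (P_lim \<mu>) \<omega> V_inf \<le> risk (P_lim \<mu>) \<omega> W" if "W \<in> subspaces_dim p" for W
        using assms(13) that by (simp add: is_arg_min_def not_less)
    qed (use assms(14,15) in blast)+
  qed
  have "\<forall>\<^sub>F t in at_top. 0 \<le> subspace_dist (V t) V_inf \<and>
      subspace_dist (V t) V_inf \<le> norm (proj_blinfun (V t) - proj_blinfun V_inf)"
    using eventually_gt_at_top[of 0]
  proof eventually_elim
    case (elim t)
    show ?case
      using V[OF elim] V_inf subspace_dist_bounds[of "V t" V_inf] by (simp add: subspaces_dim_def)
  qed
  then have "\<forall>\<^sub>F t in at_top. 0 \<le> subspace_dist (V t) V_inf"
    "\<forall>\<^sub>F t in at_top. subspace_dist (V t) V_inf \<le> norm (proj_blinfun (V t) - proj_blinfun V_inf)"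
    by (simp_all only: eventually_conj_iff)
  from tendsto_sandwich[OF this tendsto_const lim] show ?thesis .
qed

end
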